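(* Let $P$ be a finite geometric lattice of rank $n$, fix a total order on its atoms, and let $S=\{s_1<s_2<\dots<s_k\}\subseteq\{1,\dots,n-1\}$. Let $R=\mathrm{Rib}(s_1,s_2-s_1,\dots,s_k-s_{k-1},n-s_k)$. Then the elements $\bar f_{chain}(v_F)$, where $F$ ranges over the standard fillings of $R$ whose reading word is an $\mathrm{NBC}^+$ basis of $P$, form a basis of the top reduced homology $\tilde H_{k-1}(\Delta(P^S);\mathbb C)$ of the rank-selected subposet $P^S$.
   Context: A geometric lattice is a finite atomic semimodular lattice; for $x\in P$, $A(x)$ is the set of atoms $a\le x$. $P^S$ is the set of elements of $P$ with rank in $S$, and $\Delta(P^S)$ its order complex (simplices = chains), with oriented simplices written as chains in increasing order. An NBC independent set is a set $\{a_{1},\dots,a_{l}\}$ of atoms whose join has rank $l$ and such that every atom $a\notin\{a_1,\dots,a_l\}$ with $a\le a_1\vee\dots\vee a_l$ comes later in the atom order than at least one $a_j$. An $\mathrm{NBC}^+$ basis is an ordered NBC independent set $(a_{1},\dots,a_{r})$ with $r=\mathrm{rk}(P)$ such that for each $j$, $a_{j}=\min\big(A(a_1\vee\dots\vee a_j)\setminus A(a_1\vee\dots\vee a_{j-1})\big)$ (minimum in the atom order). The ribbon $\mathrm{Rib}(r_1,\dots,r_m)$ is the connected skew diagram with no $2\times2$ square whose rows, from bottom to top, have lengths $r_1,\dots,r_m$, each row beginning in the column of the last box of the row below (directly above it). A filling places one atom in each box; its reading word lists the entries left to right within rows, rows taken bottom to top. A filling is standard if entries increase (in atom order) left to right along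 rows and from top to bottom down columns. The tabloid $\{F\}$ is the class of $F$ modulo permuting entries within rows. The column group $\mathrm{Col}_F$ consists of permutations of entries preserving each column, and $v_F:=\sum_{\sigma\in\mathrm{Col}_F}\mathrm{sgn}(\sigma)\{\sigma F\}$. For a filling of $R$ whose entries form a basis of the matroid (i.e. $n$ atoms with join $\hat1$) and reading word $(F_1,\dots,F_n)$, $\bar f_{chain}(\{F\})$ is the maximal chain $F_1\vee\dots\vee F_{s_1}<F_1\vee\dots\vee F_{s_2}<\dots<F_1\vee\dots\vee F_{s_k}$ of $P^S$, viewed as an oriented $(k-1)$-simplex; $\bar f_{chain}$ is extended linearly. *)

theory Defs
  imports Complex_Main "HOL-Library.Finite_Lattice" "HOL-Library.FuncSet"
          "HOL-Combinatorics.Permutations"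
begin

definition covers :: "'a::order \<Rightarrow> 'a \<Rightarrow> bool" where
  "covers x y \<longleftrightarrow> x < y \<and> \<not> (\<exists>z. x < z \<and> z < y)"

definition is_atom :: "'a::finite_lattice_complete \<Rightarrow> bool" where
  "is_atom a \<longleftrightarrow> covers bot a"

definition atoms_below :: "'a::finite_lattice_complete \<Rightarrow> 'a set" where
  "atoms_below x = {a. is_atom a \<and> a \<le> x}"

definition is_chain :: "'a::order set \<Rightarrow> bool" where
  "is_chain C \<longleftrightarrow> (\<forall>a\<in>C. \<forall>b\<in>C. a \<le> b \<or> b \<le> a)"

text \<open>rank of x: length of a longest chain from bottom to x, i.e. the maximal
  cardinality of a chain of elements strictly below x\<close>
definition rk :: "'a::finite_lattice_complete \<Rightarrow> nat" where
  "rk x = Max {card C | C. C \<subseteq> {y. y < x} \<and> is_chain C}"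

definition atomic_lattice :: "'a::finite_lattice_complete itself \<Rightarrow> bool" where
  "atomic_lattice _ \<longleftrightarrow> (\<forall>x::'a. x = Sup (atoms_below x))"

definition semimodular_lattice :: "'a::finite_lattice_complete itself \<Rightarrow> bool" where
  "semimodular_lattice _ \<longleftrightarrow> (\<forall>x y::'a. covers (inf x y) x \<longrightarrow> covers y (sup x y))"

definition geometric_lattice :: "'a::finite_lattice_complete itself \<Rightarrow> bool" where
  "geometric_lattice T \<longleftrightarrow> atomic_lattice T \<and> semimodular_lattice T"

section \<open>NBC independent sets and NBC+ bases (w.r.t. an atom order given by
  an injective weight ord : atoms \<rightarrow> nat; a \<prec> b iff ord a < ord b)\<close>

definition nbc_independent :: "('a::finite_lattice_complete \<Rightarrow> nat) \<Rightarrow> 'a set \<Rightarrow> bool" where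
  "nbc_independent ord X \<longleftrightarrow>
     (\<forall>a\<in>X. is_atom a) \<and> rk (Sup X) = card X \<and>
     (\<forall>a. is_atom a \<and> a \<notin> X \<and> a \<le> Sup X \<longrightarrow> (\<exists>b\<in>X. ord b < ord a))"

definition nbc_plus_basis :: "('a::finite_lattice_complete \<Rightarrow> nat) \<Rightarrow> 'a list \<Rightarrow> bool" where
  "nbc_plus_basis ord as \<longleftrightarrow>
     distinct as \<and> length as = rk (top::'a) \<and> nbc_independent ord (set as) \<and>
     (\<forall>j < length as.
        let N = atoms_below (Sup (set (take (Suc j) as))) - atoms_below (Sup (set (take j as)))
        in as ! j \<in> N \<and> (\<forall>b\<in>N. ord (as ! j) \<le> ord b))"

text \<open>Cells are pairs (row, column); rows numbered 0,1,... from bottom to top,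
  row i has length rs!i and starts at column rib_start rs i; each row starts in the
  column of the last box of the row below.\<close>

definition rib_start :: "nat list \<Rightarrow> nat \<Rightarrow> nat" where
  "rib_start rs i = (\<Sum>t<i. rs ! t - 1)"

definition rib_cells :: "nat list \<Rightarrow> (nat \<times> nat) set" where
  "rib_cells rs = {(i, j). i < length rs \<and> rib_start rs i \<le> j \<and> j < rib_start rs i + rs ! i}"

definition rib_reading_cells :: "nat list \<Rightarrow> (nat \<times> nat) list" where
  "rib_reading_cells rs =
     concat (map (\<lambda>i. map (\<lambda>j. (i, j)) [rib_start rs i ..< rib_start rs i + rs ! i]) [0..<length rs])"

definition reading_word :: "nat list \<Rightarrow> (nat \<times> nat \<Rightarrow> 'a) \<Rightarrow> 'a list" where
  "reading_word rs F = map F (rib_reading_cells rs)"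

definition fillings :: "nat list \<Rightarrow> (nat \<times> nat \<Rightarrow> 'a::finite_lattice_complete) set" where
  "fillings rs = (rib_cells rs \<rightarrow>\<^sub>E {a. is_atom a})"

definition standard_filling :: "('a \<Rightarrow> nat) \<Rightarrow> nat list \<Rightarrow> (nat \<times> nat \<Rightarrow> 'a) \<Rightarrow> bool" where
  "standard_filling ord rs F \<longleftrightarrow>
     (\<forall>i j. (i, j) \<in> rib_cells rs \<and> (i, Suc j) \<in> rib_cells rs \<longrightarrow> ord (F (i, j)) < ord (F (i, Suc j))) \<and>
     (\<forall>i j. (i, j) \<in> rib_cells rs \<and> (Suc i, j) \<in> rib_cells rs \<longrightarrow> ord (F (Suc i, j)) < ord (F (i, j)))"

definition col_group :: "nat list \<Rightarrow> (nat \<times> nat \<Rightarrow> nat \<times> nat) set" where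
  "col_group rs = {\<sigma>. \<sigma> permutes rib_cells rs \<and> (\<forall>c\<in>rib_cells rs. snd (\<sigma> c) = snd c)}"

definition rib_rows :: "nat set \<Rightarrow> nat \<Rightarrow> nat list" where
  "rib_rows S n = (let ss = sorted_list_of_set S in map (\<lambda>(a, b). b - a) (zip (0 # ss) (ss @ [n])))"

definition rank_selected :: "nat set \<Rightarrow> 'a::finite_lattice_complete set" where
  "rank_selected S = {x. rk x \<in> S}"

text \<open>oriented simplices with m vertices of the order complex of X
  (chains written in increasing order); m = 0 is the empty simplex (degree -1)\<close>
definition osimplices :: "'a::order set \<Rightarrow> nat \<Rightarrow> 'a list set" where
  "osimplices X m = {xs. length xs = m \<and> sorted_wrt (<) xs \<and> set xs \<subseteq> X}"

definition ochains :: "'a::order set \<Rightarrow> nat \<Rightarrow> ('a list \<Rightarrow> complex) set" where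
  "ochains X m = {c. \<forall>xs. xs \<notin> osimplices X m \<longrightarrow> c xs = 0}"

definition del_nth :: "nat \<Rightarrow> 'a list \<Rightarrow> 'a list" where
  "del_nth i xs = take i xs @ drop (Suc i) xs"

text \<open>boundary of an (m-1)-chain (augmentation for m = 1)\<close>
definition obound :: "'a::order set \<Rightarrow> nat \<Rightarrow> ('a list \<Rightarrow> complex) \<Rightarrow> 'a list \<Rightarrow> complex" where
  "obound X m c \<tau> = (\<Sum>\<sigma>\<in>osimplices X m. \<Sum>i<m. if del_nth i \<sigma> = \<tau> then (-1) ^ i * c \<sigma> else 0)"

definition cycles :: "'a::order set \<Rightarrow> nat \<Rightarrow> ('a list \<Rightarrow> complex) set" where
  "cycles X m = {z \<in> ochains X m. \<forall>\<tau>. obound X m z \<tau> = 0}"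

definition boundaries :: "'a::order set \<Rightarrow> nat \<Rightarrow> ('a list \<Rightarrow> complex) set" where
  "boundaries X m = {b. \<exists>c \<in> ochains X (Suc m). b = obound X (Suc m) c}"

text \<open>the family v indexed by I consists of cycles whose classes form a basis
  of reduced homology in degree m-1, H~_{m-1} = cycles / boundaries\<close>
definition homology_basis ::
  "'a::order set \<Rightarrow> nat \<Rightarrow> 'i set \<Rightarrow> ('i \<Rightarrow> 'a list \<Rightarrow> complex) \<Rightarrow> bool" where
  "homology_basis X m I v \<longleftrightarrow> finite I \<and>
     (\<forall>i\<in>I. v i \<in> cycles X m) \<and>
     (\<forall>z\<in>cycles X m. \<exists>!a. a \<in> extensional I \<and>
         (\<lambda>xs. z xs - (\<Sum>i\<in>I. a i * v i xs)) \<in> boundaries X m)"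

text \<open>f_chain of (the tabloid of) a filling F: the chain of joins of prefixes of the
  reading word at positions s_1 < ... < s_k, as an elementary oriented chain\<close>
definition f_chain :: "nat set \<Rightarrow> nat \<Rightarrow> (nat \<times> nat \<Rightarrow> 'a::finite_lattice_complete) \<Rightarrow> 'a list \<Rightarrow> complex" where
  "f_chain S n F = (\<lambda>xs. if xs = map (\<lambda>s. Sup (set (take s (reading_word (rib_rows S n) F))))
                                   (sorted_list_of_set S) then 1 else 0)"

text \<open>f_chain(v_F), v_F = sum over the column group of sgn(sigma) {sigma F};
  (sigma F)(c) = F(sigma^-1 c); extended linearly\<close>
definition f_chain_vF :: "nat set \<Rightarrow> nat \<Rightarrow> (nat \<times> nat \<Rightarrow> 'a::finite_lattice_complete) \<Rightarrow> 'a list \<Rightarrow> complex" where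
  "f_chain_vF S n F = (\<lambda>xs. \<Sum>\<sigma>\<in>col_group (rib_rows S n).
        of_int (sign \<sigma>) * f_chain S n (F \<circ> inv \<sigma>) xs)"

end

(* Order bases of P, written as words, lexicographically. For a flag c with ranks S let w(c) be the
   lexicographically first word whose prefix joins at the ranks in S are the elements of c. A word w
   has the form w(c) exactly when it is an NBC+ basis that ascends at every position outside S, so
   the standard NBC+ fillings correspond to the flags whose word w(c) descends exactly at S.

   - A column permutation can only lower the (columnwise descending) word of a standard filling F,
     and the flag of the permuted filling has a word that is lower still. Hence v_F contains the
     flag of F with coefficient 1, and otherwise only flags with smaller w(c).
   - A cycle that vanishes on the flags with descent set S is 0, as is seen at a flag in its
     support with largest w(c).

   There are no boundaries in top degree, so the v_F form a basis of the cycles. *)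

theory Submission
  imports Defs "HOL-Library.List_Lexorder"
begin

section \<open>Rank in semimodular lattices\<close>

text \<open>Label a cover x < y by the first atom below y but not below x. The NBC+ bases are the
  label sequences of the maximal chains, and \<open>key_le_of_ascending\<close> says that among all
  basis words through a flag the label sequence ascending between its ranks is lexicographically
  first. This is the mechanism behind EL-shellability. The same lemma serves for S and for S with
  one rank s removed. The second use drives the argument on cycles: if the first word of a flag also
  ascends at s, it is first among the words of all flags agreeing with it away from s. The obstacle
  is that a column permutation in general destroys the NBC+ property, so a permuted word is merely a
  basis word; it is therefore bounded below by the first word of its own flag. Independence comes
  from unitriangularity and spanning from the vanishing argument, so the dimension of the homology
  is never computed.\<close>

abbreviation cover_rel :: "('a::order \<times> 'a) set" where
  "cover_rel \<equiv> {(x, y). covers x y}"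

lemma covers_less: "covers x y \<Longrightarrow> x < y"
  by (simp add: covers_def)

lemma covers_eq: "covers x y \<Longrightarrow> x < z \<Longrightarrow> z \<le> y \<Longrightarrow> z = y"
  unfolding covers_def by (metis order_le_less)

lemma ex_cover_below:
  fixes x y :: "'a::{finite,order}"
  assumes "x < y"
  shows "\<exists>z. covers x z \<and> z \<le> y"
proof -
  have "finite {z. x < z \<and> z \<le> y}" "{z. x < z \<and> z \<le> y} \<noteq> {}"
    using assms by auto
  then obtain m where m: "m \<in> {z. x < z \<and> z \<le> y}"
      "\<forall>b\<in>{z. x < z \<and> z \<le> y}. b \<le> m \<longrightarrow> m = b"
    by (meson finite_has_minimal)
  have "covers x m"
    unfolding covers_def using m by (metis (mono_tags, lifting) less_le mem_Collect_eq order.trans)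
  then show ?thesis using m(1) by blast
qed

lemma saturated_le: "(x, y) \<in> cover_rel ^^ d \<Longrightarrow> x \<le> y"
  by (induction d arbitrary: y) (auto dest!: covers_less intro: order.trans[OF _ less_imp_le])

lemma ex_saturated:
  fixes x y :: "'a::{finite,order}"
  assumes "x \<le> y"
  shows "\<exists>d. (x, y) \<in> cover_rel ^^ d"
  using assms
proof (induction "card {z. x < z}" arbitrary: x rule: less_induct)
  case less
  show ?case
  proof (cases "x = y")
    case True
    then show ?thesis by (auto intro: exI[of _ 0])
  next
    case False
    then obtain z where z: "covers x z" "z \<le> y"
      using less.prems ex_cover_below[of x y] order.not_eq_order_implies_strict by blast
    have "card {w. z < w} < card {w. x < w}"
      using covers_less[OF z(1)] by (intro psubset_card_mono) (auto dest: order.strict_trans)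
    then obtain d where "(z, y) \<in> cover_rel ^^ d"
      using less.hyps z(2) by blast
    then have "(x, y) \<in> cover_rel ^^ Suc d"
      using z(1) by (auto intro!: relpow_Suc_I2 simp del: relpow.simps)
    then show ?thesis ..
  qed
qed

lemma chain_of_saturated:
  fixes u y :: "'a::{finite,order}"
  assumes "(u, y) \<in> cover_rel ^^ d"
  shows "\<exists>C \<subseteq> {z. u \<le> z \<and> z < y}. is_chain C \<and> card C = d"
  using assms
proof (induction d arbitrary: y)
  case 0
  then show ?case by (auto simp: is_chain_def)
next
  case (Suc d)
  then obtain v where v: "(u, v) \<in> cover_rel ^^ d" "covers v y" by auto
  then obtain C where C: "C \<subseteq> {z. u \<le> z \<and> z < v}" "is_chain C" "card C = d"
    using Suc.IH by blast
  have "insert v C \<subseteq> {z. u \<le> z \<and> z < y}"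
    using C(1) saturated_le[OF v(1)] covers_less[OF v(2)] by auto
  moreover have "is_chain (insert v C)"
    using C(1,2) by (auto simp: is_chain_def)
  moreover have "card (insert v C) = Suc d"
    using C(1,3) by (subst card_insert_disjoint) auto
  ultimately show ?case by blast
qed

lemma chain_has_least:
  fixes C :: "'a::order set"
  assumes "finite C" "C \<noteq> {}" "is_chain C"
  shows "\<exists>m\<in>C. \<forall>z\<in>C. m \<le> z"
  using finite_has_minimal[OF assms(1,2)] assms(3) unfolding is_chain_def by metis

text \<open>Jordan--Dedekind: if C starts through a cover v of u other than the second element u1 of the
  saturated chain, compare both with a saturated chain through the join of u1 and v.\<close>
lemma card_chain_le_saturated:
  fixes u y :: "'a::finite_lattice_complete"
  assumes sm: "semimodular_lattice TYPE('a)"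
  assumes "(u, y) \<in> cover_rel ^^ d" "C \<subseteq> {z. u \<le> z \<and> z < y}" "is_chain C"
  shows "card C \<le> d"
  using assms(2-)
proof (induction d arbitrary: u C rule: less_induct)
  case (less d)
  show ?case
  proof (cases d)
    case 0
    then have "C = {}" using less.prems(1,2) by auto
    then show ?thesis by simp
  next
    case (Suc d')
    obtain u1 where u1: "covers u u1" "(u1, y) \<in> cover_rel ^^ d'"
      using less.prems(1) Suc relpow_Suc_D2 by (metis (mono_tags, lifting) case_prodD mem_Collect_eq)
    have "card (C - {u}) \<le> d'"
    proof (cases "C - {u} = {}")
      case False
      have ch: "is_chain (C - {u})" using less.prems(3) by (auto simp: is_chain_def)
      obtain m where m: "m \<in> C - {u}" "\<forall>z\<in>C - {u}. m \<le> z"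
        using chain_has_least[OF _ False ch] by auto
      have "u < m" using m(1) less.prems(2) by auto
      then obtain v where v: "covers u v" "v \<le> m" using ex_cover_below by blast
      have sub: "C - {u} \<subseteq> {z. v \<le> z \<and> z < y}"
        using less.prems(2) m v(2) by (auto intro: order.trans)
      have "v \<le> y" using v(2) m(1) less.prems(2) by (auto intro: order.trans)
      show ?thesis
      proof (cases "v = u1")
        case True
        then show ?thesis using less.IH[OF _ u1(2) _ ch] sub Suc by auto
      next
        case False
        have inf: "inf u1 v = u"
        proof (rule ccontr)
          assume "inf u1 v \<noteq> u"
          moreover have "u \<le> inf u1 v" using covers_less[OF u1(1)] covers_less[OF v(1)] by auto
          ultimately have "u < inf u1 v" by (metis order.not_eq_order_implies_strict)
          then have "inf u1 v = u1" "inf u1 v = v"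
            using covers_eq[OF u1(1)] covers_eq[OF v(1)] by auto
          then show False using False by simp
        qed
        define t where "t = sup u1 v"
        have "covers v t" using sm u1(1) inf unfolding semimodular_lattice_def t_def by metis
        moreover have "covers u1 t"
          using sm v(1) inf unfolding semimodular_lattice_def t_def by (metis inf.commute sup.commute)
        moreover have "t \<le> y" using \<open>v \<le> y\<close> saturated_le[OF u1(2)] by (simp add: t_def)
        then obtain e where e: "(t, y) \<in> cover_rel ^^ e" using ex_saturated by blast
        ultimately have s: "(u1, y) \<in> cover_rel ^^ Suc e" "(v, y) \<in> cover_rel ^^ Suc e"
          by (auto intro!: relpow_Suc_I2 simp del: relpow.simps)
        \<comment> \<open>The chain \<open>D\<close> serves only to bound \<open>e\<close>: the
          hypothesis at \<open>u1\<close> gives \<open>Suc e \<le> d'\<close>, which makes the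
          saturated chain from \<open>v\<close> shorter than \<open>d\<close>, so that the
          hypothesis applies there too.\<close>
        obtain D where D: "D \<subseteq> {z. u1 \<le> z \<and> z < y}" "is_chain D" "card D = Suc e"
          using chain_of_saturated[OF s(1)] by blast
        have "Suc e \<le> d'" using less.IH[OF _ u1(2) D(1,2)] D(3) Suc by simp
        moreover have "card (C - {u}) \<le> Suc e"
          using less.IH[OF _ s(2) sub ch] calculation Suc by simp
        ultimately show ?thesis by simp
      qed
    next
      case True
      then show ?thesis by (metis card.empty le0)
    qed
    then show ?thesis using Suc card_Diff1_le[of C u] by (cases "u \<in> C") auto
  qed
qed

section \<open>The rank function and joins with atoms\<close>

lemma rk_saturated:
  fixes y :: "'a::finite_lattice_complete"
  assumes sm: "semimodular_lattice TYPE('a)" and "(bot, y) \<in> cover_rel ^^ d"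
  shows "rk y = d"
  unfolding rk_def
proof (rule Max_eqI)
  show "finite {card C |C. C \<subseteq> {z. z < y} \<and> is_chain C}" by simp
  show "k \<le> d" if "k \<in> {card C |C. C \<subseteq> {z. z < y} \<and> is_chain C}" for k
    using that card_chain_le_saturated[OF assms] by auto
  show "d \<in> {card C |C. C \<subseteq> {z. z < y} \<and> is_chain C}"
    using chain_of_saturated[OF assms(2)] by auto
qed

lemma rk_bot: "rk (bot::'a::finite_lattice_complete) = 0"
proof -
  have "{card C |C. C \<subseteq> {y::'a. y < bot} \<and> is_chain C} = {0}"
    by (auto simp: is_chain_def)
  then show ?thesis by (simp add: rk_def)
qed

lemma rk_covers:
  fixes x y :: "'a::finite_lattice_complete"
  assumes sm: "semimodular_lattice TYPE('a)" and "covers x y"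
  shows "rk y = Suc (rk x)"
proof -
  obtain d where d: "(bot, x) \<in> cover_rel ^^ d" using ex_saturated[of bot x] by auto
  then have "(bot, y) \<in> cover_rel ^^ Suc d" using assms(2) by auto
  then show ?thesis using rk_saturated[OF sm] d by metis
qed

lemma rk_less:
  fixes x y :: "'a::finite_lattice_complete"
  assumes "x < y"
  shows "rk x < rk y"
proof -
  let ?K = "\<lambda>x::'a. {card C |C. C \<subseteq> {z. z < x} \<and> is_chain C}"
  have "rk x \<in> ?K x" unfolding rk_def by (rule Max_in) (auto simp: is_chain_def intro!: exI[of _ "{}"])
  then obtain C where C: "rk x = card C" "C \<subseteq> {z. z < x}" "is_chain C" by auto
  have "insert x C \<subseteq> {z. z < y}" "is_chain (insert x C)" "card (insert x C) = Suc (rk x)"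
    using C assms by (auto simp: is_chain_def card_insert_if)
  then have "Suc (rk x) \<in> ?K y" by (metis (mono_tags, lifting) mem_Collect_eq)
  then have "Suc (rk x) \<le> rk y" unfolding rk_def[of y] by (intro Max_ge) auto
  then show ?thesis by simp
qed

lemma rk_mono: "x \<le> y \<Longrightarrow> rk x \<le> rk (y::'a::finite_lattice_complete)"
  using rk_less[of x y] by (cases "x = y") (auto dest: order.not_eq_order_implies_strict)

lemma rk_le_eq: "x \<le> y \<Longrightarrow> rk y \<le> rk x \<Longrightarrow> x = (y::'a::finite_lattice_complete)"
  using rk_less[of x y] by (cases "x = y") (auto dest: order.not_eq_order_implies_strict)

lemma covers_sup_atom:
  fixes x a :: "'a::finite_lattice_complete"
  assumes "semimodular_lattice TYPE('a)" "is_atom a" "\<not> a \<le> x"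
  shows "covers x (sup x a)"
proof -
  have "inf a x = bot"
  proof (rule ccontr)
    assume "inf a x \<noteq> bot"
    then have "bot < inf a x" by (simp add: bot.not_eq_extremum)
    then have "inf a x = a" using assms(2) covers_eq[of bot a "inf a x"] by (simp add: is_atom_def)
    then show False using assms(3) by (metis inf_le2)
  qed
  then have "covers (inf a x) a" using assms(2) by (simp add: is_atom_def)
  then show ?thesis using assms(1) unfolding semimodular_lattice_def by (metis sup.commute)
qed

lemma ex_atom_le:
  fixes x y :: "'a::finite_lattice_complete"
  assumes "atomic_lattice TYPE('a)" "\<not> y \<le> x"
  shows "\<exists>a. is_atom a \<and> a \<le> y \<and> \<not> a \<le> x"
proof (rule ccontr)
  assume "\<not> ?thesis"
  then have "Sup (atoms_below y) \<le> x" by (intro Sup_least) (auto simp: atoms_below_def)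
  then show False using assms unfolding atomic_lattice_def by metis
qed

section \<open>Lexicographically first words of flags\<close>

text \<open>Words are total functions of which only the values below n matter. Replacing a letter is
  then a function update, and exchanging two letters is composition with a transposition.\<close>

definition prefix_join :: "(nat \<Rightarrow> 'a::finite_lattice_complete) \<Rightarrow> nat \<Rightarrow> 'a" where
  "prefix_join w t = Sup (w ` {..<t})"

lemma prefix_join_0 [simp]: "prefix_join w 0 = bot"
  by (simp add: prefix_join_def)

lemma prefix_join_Suc: "prefix_join w (Suc t) = sup (prefix_join w t) (w t)"
  by (simp add: prefix_join_def lessThan_Suc sup.commute)

lemma prefix_join_mono: "s \<le> t \<Longrightarrow> prefix_join w s \<le> prefix_join w t"
  unfolding prefix_join_def by (intro Sup_subset_mono image_mono) auto

lemma le_prefix_join: "p < t \<Longrightarrow> w p \<le> prefix_join w t"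
  unfolding prefix_join_def by (intro Sup_upper) auto

lemma prefix_join_cong: "(\<And>p. p < t \<Longrightarrow> u p = w p) \<Longrightarrow> prefix_join u t = prefix_join w t"
  unfolding prefix_join_def by (metis image_cong lessThan_iff)

text \<open>Only the initial segment of length \<open>Suc p\<close> separates the two exchanged
  positions. Both the sorting of words outside S and the sign cancellation in v_F rest on
  this.\<close>

lemma prefix_join_transpose:
  assumes "t \<noteq> Suc p"
  shows "prefix_join (w \<circ> transpose p (Suc p)) t = prefix_join w t"
proof -
  have "transpose p (Suc p) ` {..<t} = {..<t}"
    using assms by (cases "p < t") (auto intro!: permutes_image permutes_swap_id simp: transpose_def image_iff)
  then show ?thesis unfolding prefix_join_def by (metis image_comp)
qed

text \<open>Used with P l saying that a given atom lies below the l-th prefix join: it finds the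
  step at which the atom enters.\<close>

lemma ex_crossing:
  fixes j n :: nat
  assumes "j \<le> n" "\<not> P j" "P n"
  shows "\<exists>l\<ge>j. l < n \<and> \<not> P l \<and> P (Suc l)"
  using assms by (induction n rule: dec_induct) (auto intro: less_SucI)

locale ordered_geometric_lattice =
  fixes ord :: "'a::finite_lattice_complete \<Rightarrow> nat" and n :: nat
  assumes geometric: "geometric_lattice TYPE('a)"
    and rk_top: "rk (top::'a) = n"
    and inj_ord: "inj_on ord {a. is_atom a}"
begin

lemma semimodular: "semimodular_lattice TYPE('a)" and atomic: "atomic_lattice TYPE('a)"
  using geometric by (auto simp: geometric_lattice_def)

lemma rk_sup_atom:
  "is_atom a \<Longrightarrow> rk (sup x a) = (if a \<le> x then rk x else Suc (rk x))" for a x :: 'a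
  using rk_covers[OF semimodular covers_sup_atom[OF semimodular]]
  by (auto simp: sup.absorb1)

text \<open>Spanning by n atoms in rank n is the encoding of a basis: \<open>rk_prefix_join\<close>
  derives from it that every letter raises the rank.\<close>

definition basis_word :: "(nat \<Rightarrow> 'a) \<Rightarrow> bool" where
  "basis_word w \<longleftrightarrow> (\<forall>p<n. is_atom (w p)) \<and> prefix_join w n = top"

text \<open>In a basis word \<open>w j\<close> is itself a new atom at its step
  (\<open>not_le_prefix_join\<close>), so the two conditions together say that w is the label
  sequence of its own maximal chain.\<close>

definition minimal_labels :: "(nat \<Rightarrow> 'a) \<Rightarrow> bool" where
  "minimal_labels w \<longleftrightarrow>
     (\<forall>j<n. \<forall>b. is_atom b \<and> b \<le> prefix_join w (Suc j) \<and> \<not> b \<le> prefix_join w j \<longrightarrow> ord (w j) \<le> ord b)"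

text \<open>The letters at \<open>p\<close> and \<open>Suc p\<close> are separated by the prefix of
  length \<open>Suc p\<close>, so with positions counted from 0 their comparison belongs to rank
  \<open>Suc p\<close>.\<close>

definition ascending_off :: "nat set \<Rightarrow> (nat \<Rightarrow> 'a) \<Rightarrow> bool" where
  "ascending_off S w \<longleftrightarrow> (\<forall>p. Suc p < n \<and> Suc p \<notin> S \<longrightarrow> ord (w p) < ord (w (Suc p)))"

definition key :: "(nat \<Rightarrow> 'a) \<Rightarrow> nat list" where
  "key w = map (\<lambda>p. ord (w p)) [0..<n]"

definition flag :: "nat set \<Rightarrow> (nat \<Rightarrow> 'a) \<Rightarrow> 'a list" where
  "flag S w = map (prefix_join w) (sorted_list_of_set S)"

text \<open>All keys have length n, so the proper-prefix case of the list order never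
  occurs.\<close>

lemma key_less_iff:
  "key u < key w \<longleftrightarrow> (\<exists>j<n. (\<forall>i<j. ord (u i) = ord (w i)) \<and> ord (u j) < ord (w j))"
proof -
  have "take j (key u) = take j (key w) \<longleftrightarrow> (\<forall>i<j. ord (u i) = ord (w i))" if "j < n" for j
    using that by (auto simp: key_def take_map list_eq_iff_nth_eq)
  then show ?thesis
    by (auto simp: list_less_def lexord_take_index_conv key_def)
qed

lemma atom_eq: "ord a = ord b \<Longrightarrow> is_atom a \<Longrightarrow> is_atom b \<Longrightarrow> a = b"
  using inj_ord by (auto dest: inj_onD)

lemma key_eq:
  assumes "basis_word u" "basis_word w" "key u = key w" "p < n"
  shows "u p = w p"
  using assms atom_eq[of "u p" "w p"] by (simp add: key_def basis_word_def)

lemma rk_prefix_join_add: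
  fixes w :: "nat \<Rightarrow> 'a"
  assumes "\<And>p. p < t + k \<Longrightarrow> is_atom (w p)"
  shows "rk (prefix_join w (t + k)) \<le> rk (prefix_join w t) + k"
  using assms
proof (induction k)
  case (Suc k)
  then show ?case using rk_sup_atom[of "w (t + k)" "prefix_join w (t + k)"]
    by (auto simp: prefix_join_Suc)
qed simp

text \<open>A letter adds at most one to the rank. Rank n after n letters leaves no slack, neither
  before position t nor after it.\<close>

lemma rk_prefix_join:
  assumes "basis_word w" "t \<le> n"
  shows "rk (prefix_join w t) = t"
proof -
  have "rk (prefix_join w (t + (n - t))) \<le> rk (prefix_join w t) + (n - t)"
    using assms by (intro rk_prefix_join_add) (auto simp: basis_word_def)
  moreover have "rk (prefix_join w (0 + t)) \<le> rk (prefix_join w 0) + t"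
    using assms by (intro rk_prefix_join_add) (auto simp: basis_word_def)
  ultimately show ?thesis using assms by (simp add: basis_word_def rk_bot rk_top)
qed

lemma not_le_prefix_join:
  assumes "basis_word w" "j < n"
  shows "\<not> w j \<le> prefix_join w j"
proof
  assume "w j \<le> prefix_join w j"
  then have "prefix_join w (Suc j) = prefix_join w j" by (simp add: prefix_join_Suc sup.absorb1)
  then show False using rk_prefix_join[OF assms(1), of j] rk_prefix_join[OF assms(1), of "Suc j"] assms(2)
    by simp
qed

lemma basis_word_inj:
  assumes "basis_word w" "p < n" "q < n" "w p = w q"
  shows "p = q"
  using assms not_le_prefix_join[of w p] not_le_prefix_join[of w q] le_prefix_join[of p q w]
    le_prefix_join[of q p w] by (metis linorder_neqE_nat)

lemma prefix_join_less:
  assumes "basis_word w" "s < t" "t \<le> n"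
  shows "prefix_join w s < prefix_join w t"
  using prefix_join_mono[of s t w] rk_prefix_join[OF assms(1), of s] rk_prefix_join[OF assms(1), of t] assms
  by (metis less_imp_le order.trans order.strict_iff_order nat_neq_iff)

lemma flag_eq_iff: "finite S \<Longrightarrow> flag S u = flag S w \<longleftrightarrow> (\<forall>s\<in>S. prefix_join u s = prefix_join w s)"
  by (auto simp: flag_def)

lemma flag_osimplices:
  assumes "basis_word w" "S \<subseteq> {1..<n}"
  shows "flag S w \<in> osimplices (rank_selected S) (card S)"
proof -
  have fin: "finite S" using assms(2) finite_subset by blast
  have "sorted_wrt (<) (flag S w)"
    unfolding flag_def sorted_wrt_map
  proof (rule sorted_wrt_mono_rel[of _ "(<)"])
    show "prefix_join w s < prefix_join w t"
      if "s \<in> set (sorted_list_of_set S)" "t \<in> set (sorted_list_of_set S)" "s < t" for s t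
      using that assms fin by (intro prefix_join_less) auto
  qed simp
  then show ?thesis
    using assms fin by (auto simp: osimplices_def flag_def rank_selected_def rk_prefix_join subset_iff)
qed

section \<open>Basis words through a given flag\<close>

lemma interval_atoms:
  fixes x y :: 'a
  assumes "x \<le> y"
  shows "\<exists>l. (\<forall>a\<in>set l. is_atom a) \<and> length l = rk y - rk x \<and> sup x (Sup (set l)) = y"
  using assms
proof (induction "rk y - rk x" arbitrary: x)
  case 0
  then have "x = y" using rk_le_eq by auto
  then show ?case by (auto intro!: exI[of _ "[]"])
next
  case (Suc k)
  then have "\<not> y \<le> x" using rk_mono[of y x] by auto
  then obtain a where a: "is_atom a" "a \<le> y" "\<not> a \<le> x" using ex_atom_le[OF atomic] by blast
  have rk: "rk (sup x a) = Suc (rk x)" using a by (simp add: rk_sup_atom)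
  then have k: "k = rk y - rk (sup x a)" using Suc.hyps(2) by simp
  then obtain l where "(\<forall>a\<in>set l. is_atom a) \<and> length l = rk y - rk (sup x a) \<and> sup (sup x a) (Sup (set l)) = y"
    using Suc.hyps(1)[of "sup x a"] k Suc.prems a by auto
  then have "(\<forall>a\<in>set (a # l). is_atom a) \<and> length (a # l) = rk y - rk x \<and> sup x (Sup (set (a # l))) = y"
    using a rk Suc.hyps(2) by (auto simp: sup.assoc)
  then show ?case by blast
qed

text \<open>Atom lists for the successive intervals are concatenated. The starting element is kept
  general so that the induction can move it up to the next vertex; ranks are measured relative to
  it.\<close>

lemma chain_atoms:
  fixes x :: 'a
  assumes "sorted_wrt (<) xs" "\<forall>y\<in>set xs. x \<le> y"
  shows "\<exists>l. (\<forall>a\<in>set l. is_atom a) \<and> length l = n - rk x \<and> sup x (Sup (set l)) = top \<and>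
    (\<forall>y\<in>set xs. sup x (Sup (set (take (rk y - rk x) l))) = y)"
  using assms
proof (induction xs arbitrary: x)
  case Nil
  then show ?case using interval_atoms[of x top] by (auto simp: rk_top)
next
  case (Cons y ys)
  obtain l1 where l1: "\<forall>a\<in>set l1. is_atom a" "length l1 = rk y - rk x" "sup x (Sup (set l1)) = y"
    using interval_atoms[of x y] Cons.prems by auto
  obtain l2 where l2: "\<forall>a\<in>set l2. is_atom a" "length l2 = n - rk y" "sup y (Sup (set l2)) = top"
    "\<forall>z\<in>set ys. sup y (Sup (set (take (rk z - rk y) l2))) = z"
    using Cons.IH[of y] Cons.prems by (auto simp: less_imp_le)
  have rks: "rk x \<le> rk y" "rk y \<le> n" using Cons.prems by (auto intro: rk_mono simp flip: rk_top)
  have "sup x (Sup (set (take (rk z - rk x) (l1 @ l2)))) = z" if "z \<in> set ys" for z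
  proof -
    have "rk y \<le> rk z" using Cons.prems that by (intro rk_mono) (auto intro: less_imp_le)
    then have "take (rk z - rk x) (l1 @ l2) = l1 @ take (rk z - rk y) l2"
      using rks l1(2) by auto
    then show ?thesis using l2(4) that l1(3) by (simp add: Sup_union_distrib flip: sup.assoc)
  qed
  then show ?case using l1 l2 rks
    by (intro exI[of _ "l1 @ l2"]) (auto simp: Sup_union_distrib simp flip: sup.assoc)
qed

lemma ex_basis_word:
  assumes "S \<subseteq> {1..<n}" "xs \<in> osimplices (rank_selected S) (card S)"
  shows "\<exists>w. basis_word w \<and> flag S w = xs"
proof -
  have xs: "length xs = card S" "sorted_wrt (<) xs" "\<forall>x\<in>set xs. rk x \<in> S"
    using assms(2) by (auto simp: osimplices_def rank_selected_def)
  have fin: "finite S" using assms(1) finite_subset by blast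
  have sw: "sorted_wrt (<) (map rk xs)"
    unfolding sorted_wrt_map by (rule sorted_wrt_mono_rel[OF _ xs(2)]) (auto intro: rk_less)
  have d: "distinct (map rk xs)" using sw strict_sorted_iff by blast
  \<comment> \<open>There are as many distinct ranks as elements of S, so each rank in S occurs
    exactly once and the vertices sit at the ranks of S in order.\<close>
  have "card (set (map rk xs)) = card S" using distinct_card[OF d] xs(1) by simp
  moreover have "set (map rk xs) \<subseteq> S" using xs(3) by auto
  ultimately have "set (map rk xs) = S" using fin card_subset_eq by blast
  then have rks: "map rk xs = sorted_list_of_set S"
    using sw strict_sorted_equal[of "map rk xs" "sorted_list_of_set S"] fin by simp
  obtain l where l: "\<forall>a\<in>set l. is_atom a" "length l = n" "Sup (set l) = (top::'a)"
    "\<forall>y\<in>set xs. Sup (set (take (rk y) l)) = y"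
    using chain_atoms[OF xs(2), of bot] by (auto simp: rk_bot)
  have J: "prefix_join (nth l) t = Sup (set (take t l))" if "t \<le> n" for t
    using nth_image[of t l] that l(2) by (simp add: prefix_join_def atLeast0LessThan)
  have "basis_word (nth l)" using J[of n] l by (simp add: basis_word_def)
  moreover have "flag S (nth l) = xs"
  proof -
    have "prefix_join (nth l) (rk x) = x" if "x \<in> set xs" for x
      using J[of "rk x"] l(4) that rk_mono[of x top] by (simp add: rk_top)
    then show ?thesis unfolding flag_def rks[symmetric] by (auto intro!: map_idI)
  qed
  ultimately show ?thesis by blast
qed

text \<open>Let u be smaller, with first difference at j. The atom \<open>u j\<close> is not below
  the common prefix join, so it enters w at some step l \<ge> j, and minimality gives
  \<open>ord (w l) \<le> ord (u j) < ord (w j)\<close>. No rank of S lies strictly after j and up to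
  l, because at such a rank the joins agree and \<open>u j\<close> would already be below. Hence w
  ascends from j to l, a contradiction.\<close>

lemma key_le_of_ascending:
  assumes w: "basis_word w" "minimal_labels w" "ascending_off S w" "S \<subseteq> {1..<n}"
    and u: "basis_word u" "\<forall>s\<in>S. prefix_join u s = prefix_join w s"
  shows "key w \<le> key u"
proof (rule ccontr)
  assume "\<not> key w \<le> key u"
  then obtain j where j: "j < n" "\<forall>i<j. ord (u i) = ord (w i)" "ord (u j) < ord (w j)"
    by (auto simp: not_le key_less_iff)
  have "u i = w i" if "i < j" for i
    using that j w(1) u(1) by (intro atom_eq) (auto simp: basis_word_def)
  then have "\<not> u j \<le> prefix_join w j"
    using not_le_prefix_join[OF u(1) j(1)] prefix_join_cong[of j u w] by auto
  moreover have "u j \<le> prefix_join w n" using w(1) by (simp add: basis_word_def)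
  ultimately obtain l where l: "l < n" "\<not> u j \<le> prefix_join w l" "u j \<le> prefix_join w (Suc l)" "j \<le> l"
    using ex_crossing[of j n "\<lambda>t. u j \<le> prefix_join w t"] j(1) by auto
  have "ord (w l) \<le> ord (u j)"
    using w(2) l j(1) u(1) by (auto simp: minimal_labels_def basis_word_def)
  moreover have "ord (w j) \<le> ord (w i)" if "j \<le> i" "i \<le> l" for i
    using that
  proof (induction i rule: dec_induct)
    case (step i)
    have "Suc i \<notin> S"
    proof
      assume S: "Suc i \<in> S"
      then have "u j \<le> prefix_join w (Suc i)"
        using u(2) le_prefix_join[of j "Suc i" u] step.hyps by auto
      also have "\<dots> \<le> prefix_join w l" using step.prems by (intro prefix_join_mono) auto
      finally show False using l(2) by simp
    qed
    then show ?case using step w(3) l(1) unfolding ascending_off_def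
      by (meson Suc_leD le_less_trans less_imp_le order.trans)
  qed simp
  ultimately show False using j(3) l(4) by (meson leD le_trans order.refl)
qed

lemma key_fun_upd_less: "j < n \<Longrightarrow> ord b < ord (w j) \<Longrightarrow> key (w(j := b)) < key w"
  unfolding key_less_iff by (intro exI[of _ j]) auto

lemma key_transpose_less:
  "Suc p < n \<Longrightarrow> ord (w (Suc p)) < ord (w p) \<Longrightarrow> key (w \<circ> transpose p (Suc p)) < key w"
  unfolding key_less_iff by (intro exI[of _ p]) (auto simp: transpose_def)

text \<open>Converse of \<open>key_le_of_ascending\<close>, by two local improvements: a smaller new
  atom can replace a letter without moving any join, and exchanging the letters of a descent at a
  rank outside S moves only the join at that rank.\<close>

lemma minimal_word:
  assumes w: "basis_word w" and S: "S \<subseteq> {1..<n}"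
    and min: "\<And>u. basis_word u \<Longrightarrow> \<forall>s\<in>S. prefix_join u s = prefix_join w s \<Longrightarrow> key w \<le> key u"
  shows "minimal_labels w" and "ascending_off S w"
proof -
  show "minimal_labels w"
    unfolding minimal_labels_def
  proof (intro allI impI, elim conjE, rule ccontr)
    fix j b
    assume j: "j < n" and b: "is_atom b" "b \<le> prefix_join w (Suc j)" "\<not> b \<le> prefix_join w j"
      and "\<not> ord (w j) \<le> ord b"
    let ?u = "w(j := b)"
    have before: "prefix_join ?u t = prefix_join w t" if "t \<le> j" for t
      using that by (intro prefix_join_cong) auto
    \<comment> \<open>This step is a cover, so any new atom below its upper end generates that end;
      the replacement therefore leaves every later join as it was.\<close>
    have cov: "covers (prefix_join w j) (prefix_join w (Suc j))"
      unfolding prefix_join_Suc using not_le_prefix_join[OF w j] w j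
      by (intro covers_sup_atom semimodular) (auto simp: basis_word_def)
    have "prefix_join w j < sup (prefix_join w j) b"
      using b(3) by (metis less_le sup.cobounded1 sup.cobounded2)
    then have "prefix_join w (Suc j) = sup (prefix_join w j) b"
      using covers_eq[OF cov] b(2) prefix_join_mono[of j "Suc j" w] by fastforce
    then have at: "prefix_join ?u (Suc j) = prefix_join w (Suc j)"
      using before[of j] by (metis fun_upd_same order.refl prefix_join_Suc)
    have "prefix_join ?u t = prefix_join w t" if "Suc j \<le> t" for t
      using that
    proof (induction t rule: dec_induct)
      case base
      show ?case by (fact at)
    next
      case (step t)
      then show ?case by (simp add: prefix_join_Suc)
    qed
    then have J: "prefix_join ?u t = prefix_join w t" for t
      using before not_less_eq_eq by blast
    then have "basis_word ?u" using w b(1) by (auto simp: basis_word_def)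
    then have "key w \<le> key ?u" using J min by blast
    then show False using key_fun_upd_less[of j b w] j \<open>\<not> ord (w j) \<le> ord b\<close> by auto
  qed
  show "ascending_off S w"
    unfolding ascending_off_def
  proof (intro allI impI, elim conjE, rule ccontr)
    fix p
    assume p: "Suc p < n" "Suc p \<notin> S" "\<not> ord (w p) < ord (w (Suc p))"
    have "ord (w p) \<noteq> ord (w (Suc p))"
      using atom_eq[of "w p" "w (Suc p)"] basis_word_inj[OF w, of p "Suc p"] w p(1)
      by (auto simp: basis_word_def)
    then have less: "ord (w (Suc p)) < ord (w p)" using p(3) by simp
    let ?u = "w \<circ> transpose p (Suc p)"
    have "basis_word ?u" using w p(1) prefix_join_transpose[of n p w]
      by (auto simp: basis_word_def transpose_def)
    moreover have "\<forall>s\<in>S. prefix_join ?u s = prefix_join w s"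
      using p(2) prefix_join_transpose by metis
    ultimately have "key w \<le> key ?u" using min by blast
    then show False using key_transpose_less[of p w] p(1) less by simp
  qed
qed

text \<open>Words, being functions on all of \<open>nat\<close>, are in general infinite in number.
  Their keys are lists of length n over a finite range, so minima are taken over keys.\<close>

lemma finite_keys: "finite (key ` A)"
proof (rule finite_subset)
  show "key ` A \<subseteq> {l. set l \<subseteq> range ord \<and> length l = n}" by (auto simp: key_def)
  show "finite {l. set l \<subseteq> range ord \<and> length l = n}" by (rule finite_lists_length_eq) simp
qed

lemma ex_minimal_word:
  assumes "S \<subseteq> {1..<n}" "c \<in> osimplices (rank_selected S) (card S)"
  shows "\<exists>w. basis_word w \<and> flag S w = c \<and> (\<forall>u. basis_word u \<and> flag S u = c \<longrightarrow> key w \<le> key u)"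
proof -
  let ?A = "{w. basis_word w \<and> flag S w = c}"
  have ne: "key ` ?A \<noteq> {}" using ex_basis_word[OF assms] by blast
  obtain w where "w \<in> ?A" "key w = Min (key ` ?A)" using Min_in[OF finite_keys ne] by (metis (no_types, lifting) imageE)
  then show ?thesis using Min_le[OF finite_keys[of ?A]] by auto
qed

end

section \<open>The reading order of a ribbon\<close>

definition rib_row :: "nat set \<Rightarrow> nat \<Rightarrow> nat" where
  "rib_row S p = card {s \<in> S. s \<le> p}"

text \<open>The cell at position p of the reading word (counted from 0). Every element of S up to p
  starts a new row and costs one step to the right.\<close>
definition rib_cell :: "nat set \<Rightarrow> nat \<Rightarrow> nat \<times> nat" where
  "rib_cell S p = (rib_row S p, p - rib_row S p)"

lemma rib_row_Suc:
  assumes "finite S"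
  shows "rib_row S (Suc p) = rib_row S p + (if Suc p \<in> S then 1 else 0)"
proof -
  have "{s \<in> S. s \<le> Suc p} = (if Suc p \<in> S then insert (Suc p) {s \<in> S. s \<le> p} else {s \<in> S. s \<le> p})"
    by (auto simp: le_Suc_eq)
  then show ?thesis using assms by (simp add: rib_row_def)
qed

context
  fixes S :: "nat set" and n :: nat
  assumes S: "S \<subseteq> {1..<n}"
begin

lemma finite_ranks: "finite S"
  using S finite_subset by blast

lemma rib_row_le: "rib_row S p \<le> p"
proof -
  have "{s \<in> S. s \<le> p} \<subseteq> {1..p}" using S by auto
  then have "card {s \<in> S. s \<le> p} \<le> card {1..p}" by (intro card_mono) auto
  then show ?thesis by (simp add: rib_row_def)
qed

lemma inj_rib_cell: "inj (rib_cell S)"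
proof (rule injI)
  fix p q assume "rib_cell S p = rib_cell S q"
  then show "p = q" using rib_row_le[of p] rib_row_le[of q] by (auto simp: rib_cell_def)
qed

lemma rib_col_mono: "p \<le> q \<Longrightarrow> snd (rib_cell S p) \<le> snd (rib_cell S q)"
proof (induction q rule: dec_induct)
  case (step q)
  then show ?case using rib_row_Suc[OF finite_ranks, of q] by (auto simp: rib_cell_def)
qed simp

lemma rib_cell_Suc:
  "rib_cell S (Suc p) = (if Suc p \<in> S then (Suc (fst (rib_cell S p)), snd (rib_cell S p))
     else (fst (rib_cell S p), Suc (snd (rib_cell S p))))"
  using rib_row_Suc[OF finite_ranks, of p] rib_row_le[of p] by (simp add: rib_cell_def Suc_diff_le)

text \<open>Row and column of the cell at position p add up to p, by \<open>rib_row_le\<close>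
  without truncation. Cells adjacent in the diagram are therefore consecutive in reading
  order.\<close>

lemma rib_cell_right:
  assumes "rib_cell S p = (i, j)" "rib_cell S q = (i, Suc j)"
  shows "q = Suc p" "Suc p \<notin> S"
proof -
  show q: "q = Suc p" using assms rib_row_le[of p] rib_row_le[of q] by (auto simp: rib_cell_def)
  show "Suc p \<notin> S" using assms rib_cell_Suc[of p] q by auto
qed

lemma rib_cell_up:
  assumes "rib_cell S p = (i, j)" "rib_cell S q = (Suc i, j)"
  shows "q = Suc p" "Suc p \<in> S"
proof -
  show q: "q = Suc p" using assms rib_row_le[of p] rib_row_le[of q] by (auto simp: rib_cell_def)
  show "Suc p \<in> S" using assms rib_cell_Suc[of p] q by (auto split: if_splits)
qed

text \<open>Reading never moves left, and it moves right at every rank outside S. A column is thus a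
  run of consecutive positions separated by ranks in S only.\<close>

lemma same_col_in_ranks:
  assumes "snd (rib_cell S p) = snd (rib_cell S q)" "p \<le> r" "r < q"
  shows "Suc r \<in> S"
proof (rule ccontr)
  assume "Suc r \<notin> S"
  then have "snd (rib_cell S r) < snd (rib_cell S (Suc r))" by (simp add: rib_cell_Suc)
  then show False using rib_col_mono[of p r] rib_col_mono[of "Suc r" q] assms by linarith
qed

text \<open>Row i occupies the reading positions from \<open>cuts ! i\<close> up to but excluding
  \<open>cuts ! Suc i\<close>; the end points 0 and n make this uniform for the outer rows.\<close>

definition cuts :: "nat list" where
  "cuts = 0 # sorted_list_of_set S @ [n]"

lemma rib_rows_cuts: 
  "length (rib_rows S n) = Suc (card S)"
  "i \<le> card S \<Longrightarrow> rib_rows S n ! i = cuts ! Suc i - cuts ! i"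
  using finite_ranks
  by (auto simp: rib_rows_def Let_def cuts_def nth_append nth_Cons split: nat.splits)

lemma cuts_nth: "length cuts = Suc (Suc (card S))" "cuts ! 0 = 0" "cuts ! Suc (card S) = n"
  using finite_ranks by (auto simp: cuts_def nth_append)

lemma cuts_less:
  assumes "i \<le> card S" "S \<noteq> {} \<or> 0 < n"
  shows "cuts ! i < cuts ! Suc i"
proof -
  have n: "0 < n" using assms(2) S by auto
  have "sorted_wrt (<) cuts"
    unfolding cuts_def using S finite_ranks n by (auto simp: sorted_wrt_append)
  then show ?thesis
    using sorted_wrt_nth_less[of "(<)" cuts i "Suc i"] assms(1) cuts_nth(1) by auto
qed

lemma sorted_cuts: "sorted cuts"
  unfolding cuts_def using S finite_ranks by (auto simp: sorted_append dest: less_imp_le)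

lemma rib_row_between:
  assumes "i \<le> card S" "cuts ! i \<le> p" "p < cuts ! Suc i"
  shows "rib_row S p = i"
proof -
  let ?l = "sorted_list_of_set S"
  have l: "?l ! k = cuts ! Suc k" if "k < card S" for k
    using that finite_ranks by (simp add: cuts_def nth_append)
  have "{s \<in> S. s \<le> p} = set (take i ?l)"
  proof -
    have "s \<le> p \<longleftrightarrow> k < i" if "k < card S" "s = ?l ! k" for s k
    proof
      assume "s \<le> p"
      show "k < i"
      proof (rule ccontr)
        assume "\<not> k < i"
        then have "cuts ! Suc i \<le> cuts ! Suc k"
          using that cuts_nth(1) by (intro sorted_nth_mono[OF sorted_cuts]) auto
        then show False using assms that l[of k] \<open>s \<le> p\<close> by simp
      qed
    next
      assume "k < i"
      then have "cuts ! Suc k \<le> cuts ! i"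
        using assms cuts_nth(1) by (intro sorted_nth_mono[OF sorted_cuts]) auto
      then show "s \<le> p" using assms that l[of k] by simp
    qed
    note * = this
    have S_nth: "s \<in> S \<longleftrightarrow> (\<exists>k<card S. s = ?l ! k)" for s
      using in_set_conv_nth[of s ?l] finite_ranks by auto
    have take_nth: "s \<in> set (take i ?l) \<longleftrightarrow> (\<exists>k<i. s = ?l ! k)" for s
      using in_set_conv_nth[of s "take i ?l"] assms(1) by auto
    show ?thesis
    proof (intro set_eqI iffI)
      fix s assume "s \<in> {s \<in> S. s \<le> p}"
      then show "s \<in> set (take i ?l)" using * unfolding take_nth S_nth by blast
    next
      fix s assume "s \<in> set (take i ?l)"
      then obtain k where "k < i" "s = ?l ! k" unfolding take_nth by blast
      then show "s \<in> {s \<in> S. s \<le> p}"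
        using *[of k s] S_nth[of s] assms(1) by (auto intro: less_le_trans)
    qed
  qed
  then show ?thesis
    using distinct_card[of "take i ?l"] assms(1) finite_ranks by (simp add: rib_row_def)
qed

text \<open>Consecutive rows share a column, so the start of row i lags i behind its reading
  position. The truncated subtraction in \<open>rib_start\<close> is exact for non-empty rows; in
  the step S is non-empty, which excludes the empty row of the case n = 0.\<close>

lemma rib_start_cuts: "i \<le> card S \<Longrightarrow> rib_start (rib_rows S n) i + i = cuts ! i"
proof (induction i)
  case 0
  then show ?case by (simp add: rib_start_def cuts_nth)
next
  case (Suc i)
  have "S \<noteq> {}" using Suc.prems by auto
  then have "cuts ! i < cuts ! Suc i" using cuts_less[of i] Suc.prems by auto
  then show ?case using Suc rib_rows_cuts(2)[of i] by (simp add: rib_start_def)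
qed

lemma concat_upt_cuts:
  "m \<le> Suc (card S) \<Longrightarrow> concat (map (\<lambda>i. [cuts ! i..<cuts ! Suc i]) [0..<m]) = [0..<cuts ! m]"
proof (induction m)
  case 0
  then show ?case by (simp add: cuts_nth)
next
  case (Suc m)
  have "cuts ! m \<le> cuts ! Suc m"
    using sorted_nth_mono[OF sorted_cuts, of m "Suc m"] Suc.prems cuts_nth(1) by simp
  then show ?case using Suc upt_add_eq_append[of 0 "cuts ! m" "cuts ! Suc m - cuts ! m"] by simp
qed

text \<open>The bridge from the diagram to positions 0 to n - 1: fillings become words through
  \<open>rib_cell S\<close>.\<close>

lemma rib_reading_cells_eq: "rib_reading_cells (rib_rows S n) = map (rib_cell S) [0..<n]"
proof -
  let ?rs = "rib_rows S n"
  have row: "map (\<lambda>j. (i, j)) [rib_start ?rs i..<rib_start ?rs i + ?rs ! i] =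
      map (rib_cell S) [cuts ! i..<cuts ! Suc i]" if i: "i \<le> card S" for i
  proof -
    have le: "cuts ! i \<le> cuts ! Suc i"
      using sorted_nth_mono[OF sorted_cuts, of i "Suc i"] i cuts_nth(1) by simp
    have st: "rib_start ?rs i + i = cuts ! i" using rib_start_cuts i .
    show ?thesis
    proof (rule nth_equalityI)
      show "length (map (\<lambda>j. (i, j)) [rib_start ?rs i..<rib_start ?rs i + ?rs ! i]) =
        length (map (rib_cell S) [cuts ! i..<cuts ! Suc i])"
        using rib_rows_cuts(2)[OF i] by simp
      fix k assume "k < length (map (\<lambda>j. (i, j)) [rib_start ?rs i..<rib_start ?rs i + ?rs ! i])"
      then have k: "k < cuts ! Suc i - cuts ! i" using rib_rows_cuts(2)[OF i] by simp
      then show "map (\<lambda>j. (i, j)) [rib_start ?rs i..<rib_start ?rs i + ?rs ! i] ! k =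
        map (rib_cell S) [cuts ! i..<cuts ! Suc i] ! k"
        using rib_row_between[OF i, of "cuts ! i + k"] rib_rows_cuts(2)[OF i] st
        by (auto simp: rib_cell_def)
    qed
  qed
  have "rib_reading_cells ?rs = concat (map (\<lambda>i. map (rib_cell S) [cuts ! i..<cuts ! Suc i]) [0..<Suc (card S)])"
    unfolding rib_reading_cells_def rib_rows_cuts(1)
    by (intro arg_cong[of _ _ concat] list.map_cong0 row) auto
  also have "\<dots> = map (rib_cell S) (concat (map (\<lambda>i. [cuts ! i..<cuts ! Suc i]) [0..<Suc (card S)]))"
    by (simp only: map_concat map_map comp_def)
  also have "\<dots> = map (rib_cell S) [0..<n]" by (simp only: concat_upt_cuts cuts_nth order.refl)
  finally show ?thesis .
qed

lemma rib_cells_eq: "rib_cells (rib_rows S n) = rib_cell S ` {..<n}"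
proof -
  have "rib_cells (rib_rows S n) = set (rib_reading_cells (rib_rows S n))"
    by (auto simp: rib_cells_def rib_reading_cells_def)
  then show ?thesis by (simp add: rib_reading_cells_eq lessThan_atLeast0)
qed

lemma reading_word_eq: "reading_word (rib_rows S n) F = map (\<lambda>p. F (rib_cell S p)) [0..<n]"
  by (simp add: reading_word_def rib_reading_cells_eq)

lemma standard_filling_iff:
  "standard_filling ord (rib_rows S n) F \<longleftrightarrow>
     (\<forall>p. Suc p < n \<longrightarrow> (if Suc p \<in> S then ord (F (rib_cell S (Suc p))) < ord (F (rib_cell S p))
        else ord (F (rib_cell S p)) < ord (F (rib_cell S (Suc p)))))" (is "?L \<longleftrightarrow> ?R")
proof
  assume L: ?L
  show ?R
  proof (intro allI impI)
    fix p assume "Suc p < n"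
    then have "rib_cell S p \<in> rib_cells (rib_rows S n)" "rib_cell S (Suc p) \<in> rib_cells (rib_rows S n)"
      by (auto simp: rib_cells_eq)
    then show "if Suc p \<in> S then ord (F (rib_cell S (Suc p))) < ord (F (rib_cell S p))
        else ord (F (rib_cell S p)) < ord (F (rib_cell S (Suc p)))"
      using L rib_cell_Suc[of p] unfolding standard_filling_def
      by (cases "rib_cell S p") (auto split: if_splits)
  qed
next
  assume R: ?R
  show ?L
    unfolding standard_filling_def
  proof (intro conjI allI impI; elim conjE)
    fix i j assume "(i, j) \<in> rib_cells (rib_rows S n)" "(i, Suc j) \<in> rib_cells (rib_rows S n)"
    then obtain p q where "p < n" "q < n" "rib_cell S p = (i, j)" "rib_cell S q = (i, Suc j)"
      unfolding rib_cells_eq by (metis imageE lessThan_iff)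
    then show "ord (F (i, j)) < ord (F (i, Suc j))"
      using R[rule_format, of p] rib_cell_right[of p i j q] by auto
  next
    fix i j assume "(i, j) \<in> rib_cells (rib_rows S n)" "(Suc i, j) \<in> rib_cells (rib_rows S n)"
    then obtain p q where "p < n" "q < n" "rib_cell S p = (i, j)" "rib_cell S q = (Suc i, j)"
      unfolding rib_cells_eq by (metis imageE lessThan_iff)
    then show "ord (F (Suc i, j)) < ord (F (i, j))"
      using R[rule_format, of p] rib_cell_up[of p i j q] by auto
  qed
qed

end

section \<open>Top-degree cycles\<close>

text \<open>The element m inserted last has maximal rank, so \<open>M i m = 0\<close> for all
  earlier i. The equation at m then forces the coefficient \<open>b m\<close>, and the others solve
  the system corrected by \<open>b m * M m j\<close>.\<close>

lemma triangular_solution: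
  fixes M :: "'i \<Rightarrow> 'i \<Rightarrow> complex" and rank :: "'i \<Rightarrow> 'k::linorder"
  assumes "finite I" and "\<And>i. i \<in> I \<Longrightarrow> M i i = 1"
    and "\<And>i j. i \<in> I \<Longrightarrow> j \<in> I \<Longrightarrow> M i j \<noteq> 0 \<Longrightarrow> i = j \<or> rank j < rank i"
  shows "\<exists>a. \<forall>j\<in>I. (\<Sum>i\<in>I. a i * M i j) = b j"
  using assms
proof (induction I arbitrary: b rule: finite_ranking_induct[where f = rank])
  case empty
  then show ?case by simp
next
  case (insert m I)
  show ?case
  proof (cases "m \<in> I")
    \<comment> \<open>The ranking induction does not guarantee that the inserted element is
      new.\<close>
    case True
    then show ?thesis using insert by (simp add: insert_absorb)
  next
    case False
    obtain a where a: "\<forall>j\<in>I. (\<Sum>i\<in>I. a i * M i j) = b j - b m * M m j"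
      using insert.IH[of "\<lambda>j. b j - b m * M m j"] insert.prems by blast
    let ?a = "a(m := b m)"
    have "(\<Sum>i\<in>insert m I. ?a i * M i j) = b m * M m j + (\<Sum>i\<in>I. a i * M i j)" for j
    proof -
      have "(\<Sum>i\<in>I. ?a i * M i j) = (\<Sum>i\<in>I. a i * M i j)"
        using False by (intro sum.cong) auto
      then show ?thesis using False insert.hyps(1) by simp
    qed
    moreover have "(\<Sum>i\<in>I. a i * M i m) = 0"
    proof (rule sum.neutral, rule ballI)
      fix i assume i: "i \<in> I"
      then have "M i m = 0" using insert.hyps(2)[of i] insert.prems(2)[of i m] False by (metis insertCI leD)
      then show "a i * M i m = 0" by simp
    qed
    ultimately have "\<forall>j\<in>insert m I. (\<Sum>i\<in>insert m I. ?a i * M i j) = b j"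
      using a insert.prems(1)[of m] by simp
    then show ?thesis by blast
  qed
qed

lemma triangular_kernel:
  fixes M :: "'i \<Rightarrow> 'i \<Rightarrow> complex" and rank :: "'i \<Rightarrow> 'k::linorder"
  assumes "finite I" and "\<And>i. i \<in> I \<Longrightarrow> M i i = 1"
    and "\<And>i j. i \<in> I \<Longrightarrow> j \<in> I \<Longrightarrow> M i j \<noteq> 0 \<Longrightarrow> i = j \<or> rank j < rank i"
    and "\<forall>j\<in>I. (\<Sum>i\<in>I. a i * M i j) = 0"
  shows "\<forall>i\<in>I. a i = 0"
  using assms
proof (induction I rule: finite_ranking_induct[where f = rank])
  case empty
  then show ?case by simp
next
  case (insert m I)
  show ?case
  proof (cases "m \<in> I")
    case True
    then show ?thesis using insert by (simp add: insert_absorb)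
  next
    case False
    have "(\<Sum>i\<in>I. a i * M i m) = 0"
    proof (rule sum.neutral, rule ballI)
      fix i assume i: "i \<in> I"
      then have "M i m = 0" using insert.hyps(2)[of i] insert.prems(2)[of i m] False by (metis insertCI leD)
      then show "a i * M i m = 0" by simp
    qed
    moreover have "(\<Sum>i\<in>insert m I. a i * M i m) = 0" using insert.prems(3) by blast
    ultimately have "a m = 0" using False insert.hyps(1) insert.prems(1)[of m] by simp
    then have "\<forall>j\<in>I. (\<Sum>i\<in>I. a i * M i j) = 0"
      using insert.prems(3) False insert.hyps(1) by simp
    then show ?thesis using insert.IH insert.prems \<open>a m = 0\<close> by blast
  qed
qed

section \<open>The boundary map in top degree and the column group\<close>

lemma obound_combination:
  fixes X :: "'a::order set"
  assumes "finite I"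
  shows "obound X m (\<lambda>xs. z xs - (\<Sum>i\<in>I. a i * v i xs)) \<tau> =
    obound X m z \<tau> - (\<Sum>i\<in>I. a i * obound X m (v i) \<tau>)"
proof -
  have "obound X m (\<lambda>xs. z xs - (\<Sum>i\<in>I. a i * v i xs)) \<tau> =
    (\<Sum>\<sigma>\<in>osimplices X m. \<Sum>j<m. (if del_nth j \<sigma> = \<tau> then (-1) ^ j * z \<sigma> else 0) -
      (\<Sum>i\<in>I. a i * (if del_nth j \<sigma> = \<tau> then (-1) ^ j * v i \<sigma> else 0)))"
    unfolding obound_def
    by (intro sum.cong refl) (simp add: right_diff_distrib sum_distrib_left mult.left_commute)
  also have "\<dots> = obound X m z \<tau> - (\<Sum>\<sigma>\<in>osimplices X m. \<Sum>j<m. \<Sum>i\<in>I.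
      a i * (if del_nth j \<sigma> = \<tau> then (-1) ^ j * v i \<sigma> else 0))"
    by (simp only: sum_subtractf obound_def)
  also have "(\<Sum>\<sigma>\<in>osimplices X m. \<Sum>j<m. \<Sum>i\<in>I. a i * (if del_nth j \<sigma> = \<tau> then (-1) ^ j * v i \<sigma> else 0)) =
      (\<Sum>i\<in>I. a i * obound X m (v i) \<tau>)"
    unfolding obound_def sum_distrib_left
    by (subst (2) sum.swap, subst sum.swap) (rule refl)
  finally show ?thesis .
qed

lemma cycles_combination:
  fixes X :: "'a::order set"
  assumes "finite I" "z \<in> cycles X m" "\<And>i. i \<in> I \<Longrightarrow> v i \<in> cycles X m"
  shows "(\<lambda>xs. z xs - (\<Sum>i\<in>I. a i * v i xs)) \<in> cycles X m"
  using assms by (simp add: cycles_def ochains_def obound_combination)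

lemma finite_osimplices: "finite (osimplices (X :: 'a::{finite,order} set) m)"
proof (rule finite_subset)
  show "osimplices X m \<subseteq> {xs. set xs \<subseteq> UNIV \<and> length xs = m}" by (auto simp: osimplices_def)
qed (rule finite_lists_length_eq, simp)

lemma osimplices_rank_selected_empty:
  assumes "finite S" "card S < m"
  shows "osimplices (rank_selected S :: 'a::finite_lattice_complete set) m = {}"
proof (rule ccontr)
  assume "osimplices (rank_selected S :: 'a set) m \<noteq> {}"
  then obtain xs :: "'a list" where xs: "length xs = m" "sorted_wrt (<) xs" "\<forall>x\<in>set xs. rk x \<in> S"
    by (auto simp: osimplices_def rank_selected_def)
  have "sorted_wrt (<) (map rk xs)"
    unfolding sorted_wrt_map by (rule sorted_wrt_mono_rel[OF _ xs(2)]) (auto intro: rk_less)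
  then have "distinct (map rk xs)" using strict_sorted_iff by blast
  then have "m = card (set (map rk xs))" using distinct_card xs(1) by (metis length_map)
  also have "\<dots> \<le> card S" using xs(3) assms(1) by (intro card_mono) auto
  finally show False using assms(2) by simp
qed

lemma boundaries_rank_selected:
  assumes "finite S"
  shows "boundaries (rank_selected S :: 'a::finite_lattice_complete set) (card S) = {\<lambda>_. 0}"
proof -
  have "obound (rank_selected S :: 'a set) (Suc (card S)) c = (\<lambda>_. 0)" for c
    by (simp add: obound_def osimplices_rank_selected_empty[OF assms] fun_eq_iff)
  moreover have "(\<lambda>_. 0) \<in> ochains (rank_selected S :: 'a set) (Suc (card S))"
    by (simp add: ochains_def)
  ultimately show ?thesis unfolding boundaries_def by auto
qed

lemma del_nth_sorted_list_of_set:
  assumes "finite S" "i < card S"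
  shows "del_nth i (sorted_list_of_set S) = sorted_list_of_set (S - {sorted_list_of_set S ! i})"
proof -
  let ?l = "sorted_list_of_set S"
  have l: "?l = take i ?l @ ?l ! i # drop (Suc i) ?l"
    using assms by (intro id_take_nth_drop) auto
  have "distinct ?l" by simp
  then have "?l ! i \<notin> set (take i ?l)"
    using l by (metis distinct_append disjoint_iff list.set_intros(1))
  then have "remove1 (?l ! i) ?l = del_nth i ?l"
    unfolding del_nth_def by (subst l) (simp add: remove1_append)
  then show ?thesis using assms(1) by (simp add: sorted_list_of_set_remove)
qed

lemma finite_col_group: "finite (rib_cells rs) \<Longrightarrow> finite (col_group rs)"
  unfolding col_group_def by (rule finite_subset[OF _ finite_permutations]) auto

lemma col_group_inv:
  assumes "\<sigma> \<in> col_group rs" "c \<in> rib_cells rs"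
  shows "inv \<sigma> c \<in> rib_cells rs" "snd (inv \<sigma> c) = snd c"
proof -
  have \<sigma>: "\<sigma> permutes rib_cells rs" and col: "\<forall>c\<in>rib_cells rs. snd (\<sigma> c) = snd c"
    using assms(1) by (auto simp: col_group_def)
  show c: "inv \<sigma> c \<in> rib_cells rs" using \<sigma> assms(2) by (metis permutes_in_image permutes_inv)
  show "snd (inv \<sigma> c) = snd c" using col c permutes_inverses(1)[OF \<sigma>] by metis
qed

context ordered_geometric_lattice
begin

definition descending_on :: "nat set \<Rightarrow> (nat \<Rightarrow> 'a) \<Rightarrow> bool" where
  "descending_on S w \<longleftrightarrow> (\<forall>p. Suc p < n \<and> Suc p \<in> S \<longrightarrow> ord (w (Suc p)) < ord (w p))"

text \<open>A face of a flag is the flag of the same word for a smaller rank set, so comparisons of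
  flags also apply to ridges.\<close>

lemma del_nth_flag:
  assumes "finite S" "i < card S"
  shows "del_nth i (flag S w) = flag (S - {sorted_list_of_set S ! i}) w"
proof -
  have "del_nth i (flag S w) = map (prefix_join w) (del_nth i (sorted_list_of_set S))"
    by (simp add: flag_def del_nth_def take_map drop_map)
  then show ?thesis using del_nth_sorted_list_of_set[OF assms] by (simp add: flag_def)
qed

lemma map_rk_flag:
  assumes "basis_word w" "S \<subseteq> {1..<n}"
  shows "map rk (flag S w) = sorted_list_of_set S"
  unfolding flag_def map_map
proof (rule map_idI)
  fix s assume "s \<in> set (sorted_list_of_set S)"
  moreover have "finite S" using assms(2) finite_subset by blast
  ultimately show "(rk \<circ> prefix_join w) s = s" using assms rk_prefix_join[of w s] by auto
qed

lemma prefix_join_set_take: "t \<le> n \<Longrightarrow> Sup (set (take t (map w [0..<n]))) = prefix_join w t"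
  by (simp add: take_map prefix_join_def lessThan_atLeast0)

text \<open>The NBC condition on the whole set follows from stepwise minimality: an atom outside the
  word enters at some step j, and it comes after \<open>w j\<close>. Conversely, n distinct letters
  whose join has rank n have join top.\<close>

lemma nbc_plus_basis_iff:
  "nbc_plus_basis ord (map w [0..<n]) \<longleftrightarrow> basis_word w \<and> minimal_labels w"
proof -
  let ?l = "map w [0..<n]"
  have top: "Sup (set ?l) = prefix_join w n"
    using prefix_join_set_take[of n w] by simp
  have labels: "(\<forall>j < length ?l.
        let N = atoms_below (Sup (set (take (Suc j) ?l))) - atoms_below (Sup (set (take j ?l)))
        in ?l ! j \<in> N \<and> (\<forall>b\<in>N. ord (?l ! j) \<le> ord b)) \<longleftrightarrow>
     (\<forall>j<n. is_atom (w j) \<and> \<not> w j \<le> prefix_join w j) \<and> minimal_labels w"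
  proof -
    have "Sup (set (take j ?l)) = prefix_join w j" "Sup (set (take (Suc j) ?l)) = prefix_join w (Suc j)"
      if "j < n" for j
      using prefix_join_set_take[of j w] prefix_join_set_take[of "Suc j" w] that by auto
    then show ?thesis
      using le_prefix_join[of _ "Suc _" w] unfolding minimal_labels_def atoms_below_def Let_def
      by (simp del: take_map map_upt_Suc) blast
  qed
  show ?thesis
  proof
    assume L: "nbc_plus_basis ord ?l"
    then have "rk (Sup (set ?l)) = card (set ?l)" "distinct ?l"
      unfolding nbc_plus_basis_def nbc_independent_def by blast+
    then have "rk (prefix_join w n) = n"
      using top distinct_card[of ?l] by simp
    then have "prefix_join w n = top" using rk_le_eq[of "prefix_join w n" top] rk_top by simp
    then show "basis_word w \<and> minimal_labels w"
      using L labels unfolding nbc_plus_basis_def basis_word_def by blast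
  next
    assume R: "basis_word w \<and> minimal_labels w"
    then have w: "basis_word w" and m: "minimal_labels w" by auto
    have d: "distinct ?l" using basis_word_inj[OF w] by (auto simp: distinct_map intro!: inj_onI)
    have "\<exists>b\<in>set ?l. ord b < ord a" if a: "is_atom a" "a \<notin> set ?l" for a
    proof -
      have "\<not> a \<le> prefix_join w 0" using a(1) by (auto simp: is_atom_def covers_def)
      moreover have "a \<le> prefix_join w n" using w by (simp add: basis_word_def)
      ultimately obtain j where j: "j < n" "\<not> a \<le> prefix_join w j" "a \<le> prefix_join w (Suc j)"
        using ex_crossing[of 0 n "\<lambda>t. a \<le> prefix_join w t"] by auto
      then have "ord (w j) \<le> ord a" using m a(1) by (auto simp: minimal_labels_def)
      moreover have "ord (w j) \<noteq> ord a"
        using atom_eq[of "w j" a] a w j(1) by (auto simp: basis_word_def)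
      ultimately show ?thesis using j(1) by (intro bexI[of _ "w j"]) auto
    qed
    then have "nbc_independent ord (set ?l)"
      unfolding nbc_independent_def
      using top w distinct_card[OF d] rk_top by (auto simp: basis_word_def)
    then show "nbc_plus_basis ord ?l"
      unfolding nbc_plus_basis_def labels
      using d m w not_le_prefix_join[OF w] rk_top by (auto simp: basis_word_def)
  qed
qed

text \<open>Take the facet outside the zero set of z whose key is largest. If its word ascends at a rank in S,
  it has the smallest key among all facets sharing the ridge obtained by deleting that rank, so the
  boundary of z at this ridge would not vanish.\<close>
lemma cycle_vanishes:
  assumes S: "S \<subseteq> {1..<n}"
    and z: "z \<in> cycles (rank_selected S :: 'a set) (card S)"
    and van: "\<And>w. basis_word w \<Longrightarrow> minimal_labels w \<Longrightarrow> ascending_off S w \<Longrightarrow> descending_on S w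
       \<Longrightarrow> z (flag S w) = 0"
  shows "z xs = 0"
proof (rule ccontr)
  assume nz: "z xs \<noteq> 0"
  let ?O = "osimplices (rank_selected S :: 'a set) (card S)"
  have fin: "finite S" using S finite_subset by blast
  have supp: "c \<in> ?O" if "z c \<noteq> 0" for c using z that by (auto simp: cycles_def ochains_def)
  have "\<forall>c\<in>?O. \<exists>w. basis_word w \<and> flag S w = c \<and> (\<forall>u. basis_word u \<and> flag S u = c \<longrightarrow> key w \<le> key u)"
    using ex_minimal_word[OF S] by blast
  then obtain W where W: "\<And>c. c \<in> ?O \<Longrightarrow> basis_word (W c)" "\<And>c. c \<in> ?O \<Longrightarrow> flag S (W c) = c"
    "\<And>c u. c \<in> ?O \<Longrightarrow> basis_word u \<Longrightarrow> flag S u = c \<Longrightarrow> key (W c) \<le> key u"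
    using bchoice by (metis (no_types, lifting))
  let ?B = "{c \<in> ?O. z c \<noteq> 0}"
  have "finite ?B" by (rule finite_subset[OF _ finite_osimplices]) auto
  moreover have "?B \<noteq> {}" using supp[OF nz] nz by auto
  ultimately obtain c where c: "c \<in> ?B" "key (W c) = Max ((key \<circ> W) ` ?B)"
    using Max_in[of "(key \<circ> W) ` ?B"] by (auto simp: image_iff)
  have cmax: "key (W d) \<le> key (W c)" if "d \<in> ?B" for d
    using Max_ge[of "(key \<circ> W) ` ?B" "key (W d)"] c(2) \<open>finite ?B\<close> that by auto
  define w where "w = W c"
  have cO: "c \<in> ?O" and cz: "z c \<noteq> 0" using c(1) by auto
  have w: "basis_word w" "flag S w = c" using W(1,2)[OF cO] by (auto simp: w_def)
  have min: "key w \<le> key u" if "basis_word u" "\<forall>s\<in>S. prefix_join u s = prefix_join w s" for u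
    using W(3)[OF cO that(1)] flag_eq_iff[OF fin, of u w] that(2) w(2) by (simp add: w_def)
  have ml: "minimal_labels w" "ascending_off S w"
    by (rule minimal_word[OF w(1) S], erule (1) min)+
  have "\<not> descending_on S w" using van[OF w(1) ml] w(2) cz by auto
  then obtain p where p: "Suc p < n" "Suc p \<in> S" "\<not> ord (w (Suc p)) < ord (w p)"
    by (auto simp: descending_on_def)
  have "ord (w p) \<noteq> ord (w (Suc p))"
    using atom_eq[of "w p" "w (Suc p)"] basis_word_inj[OF w(1), of p "Suc p"] w(1) p(1)
    by (auto simp: basis_word_def)
  \<comment> \<open>Neighbouring labels of a basis word differ, so the missing descent is an ascent,
    and w qualifies as a first word for the smaller rank set.\<close>
  then have up: "ascending_off (S - {Suc p}) w"
    using ml(2) p(3) unfolding ascending_off_def by (auto simp: not_less le_less)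
  obtain i where i: "i < card S" "sorted_list_of_set S ! i = Suc p"
    using p(2) fin in_set_conv_nth[of "Suc p" "sorted_list_of_set S"] by auto
  \<comment> \<open>The ranks in a ridge reveal which vertex was deleted, so a facet can contain
    this ridge only as its i-th face.\<close>
  have idx: "j = i" if d: "d \<in> ?O" and j: "j < card S" and eq: "del_nth j d = del_nth i c" for d j
  proof -
    have "flag (S - {sorted_list_of_set S ! j}) (W d) = flag (S - {Suc p}) w"
      using eq W(2)[OF d] w(2) del_nth_flag[OF fin j, of "W d"] del_nth_flag[OF fin i(1), of w] i(2) by simp
    moreover have "map rk (flag (S - {s}) (W d)) = sorted_list_of_set (S - {s})"
       "map rk (flag (S - {s}) w) = sorted_list_of_set (S - {s})" for s
      using S by (intro map_rk_flag W(1)[OF d] w(1); blast)+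
    ultimately have "sorted_list_of_set (S - {sorted_list_of_set S ! j}) = sorted_list_of_set (S - {Suc p})"
      by metis
    then have "S - {sorted_list_of_set S ! j} = S - {Suc p}"
      using fin by (metis finite_Diff set_sorted_list_of_set)
    moreover have "sorted_list_of_set S ! j \<in> S" using j fin nth_mem[of j "sorted_list_of_set S"] by simp
    ultimately have "sorted_list_of_set S ! j = sorted_list_of_set S ! i" using p(2) i(2) by auto
    then show ?thesis
      using nth_eq_iff_index_eq[of "sorted_list_of_set S" j i] j i(1) fin by simp
  qed
  \<comment> \<open>The choice of \<open>c\<close> bounds \<open>key (W d)\<close> above by
    \<open>key w\<close>, and the ascent at \<open>Suc p\<close> bounds it below. Equal keys have
    equal letters, hence equal flags.\<close>
  have others: "z d = 0" if d: "d \<in> ?O" "del_nth i d = del_nth i c" "d \<noteq> c" for d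
  proof (rule ccontr)
    assume "z d \<noteq> 0"
    then have le: "key (W d) \<le> key w" using cmax[of d] d(1) by (simp add: w_def)
    have "flag (S - {Suc p}) (W d) = flag (S - {Suc p}) w"
      using d(2) W(2)[OF d(1)] w(2) del_nth_flag[OF fin i(1)] i(2) by metis
    then have "\<forall>s\<in>S - {Suc p}. prefix_join (W d) s = prefix_join w s"
      using flag_eq_iff[of "S - {Suc p}"] fin by blast
    then have "key w \<le> key (W d)"
      using S by (intro key_le_of_ascending[OF w(1) ml(1) up _ W(1)[OF d(1)]]) auto
    then have "key (W d) = key w" using le by simp
    then have eq: "W d q = w q" if "q < n" for q using key_eq[OF W(1)[OF d(1)] w(1) _ that] by blast
    have "prefix_join (W d) s = prefix_join w s" if "s \<in> S" for s
      using S that eq by (intro prefix_join_cong) auto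
    then have "d = c" using flag_eq_iff[OF fin, of "W d" w] W(2)[OF d(1)] w(2) by simp
    then show False using d(3) by simp
  qed
  have facet_term: "(\<Sum>j<card S. if del_nth j d = del_nth i c then (-1) ^ j * z d else 0) = 
      (if d = c then (-1) ^ i * z c else 0)" if d: "d \<in> ?O" for d
  proof -
    have "(\<Sum>j<card S. if del_nth j d = del_nth i c then (-1) ^ j * z d else 0) =
      (\<Sum>j<card S. if j = i then (if del_nth i d = del_nth i c then (-1) ^ i * z d else 0) else 0)"
      using idx[OF d] by (intro sum.cong) auto
    also have "\<dots> = (if del_nth i d = del_nth i c then (-1) ^ i * z d else 0)"
      using i(1) by simp
    also have "\<dots> = (if d = c then (-1) ^ i * z c else 0)" using others[OF d] by auto
    finally show ?thesis .
  qed
  have "0 = obound (rank_selected S) (card S) z (del_nth i c)" using z by (simp add: cycles_def)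
  also have "\<dots> = (\<Sum>d\<in>?O. if d = c then (-1) ^ i * z c else 0)"
    unfolding obound_def by (intro sum.cong refl facet_term)
  also have "\<dots> = (-1) ^ i * z c" using cO by (simp add: finite_osimplices)
  finally show False using cz by simp
qed

section \<open>The cycles of standard fillings\<close>

definition standard_nbc_fillings :: "nat set \<Rightarrow> (nat \<times> nat \<Rightarrow> 'a) set" where
  "standard_nbc_fillings S = {F \<in> fillings (rib_rows S n). standard_filling ord (rib_rows S n) F \<and>
     nbc_plus_basis ord (reading_word (rib_rows S n) F)}"

context
  fixes S :: "nat set"
  assumes S: "S \<subseteq> {1..<n}"
begin

abbreviation cells :: "(nat \<times> nat) set" where
  "cells \<equiv> rib_cells (rib_rows S n)"

abbreviation word :: "(nat \<times> nat \<Rightarrow> 'a) \<Rightarrow> nat \<Rightarrow> 'a" where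
  "word F \<equiv> F \<circ> rib_cell S"

lemma finite_S: "finite S"
  using S finite_subset by blast

lemma finite_cells: "finite cells"
  by (simp add: rib_cells_eq[OF S])

lemma standard_nbc_fillings_iff:
  "F \<in> standard_nbc_fillings S \<longleftrightarrow> F \<in> fillings (rib_rows S n) \<and> basis_word (word F) \<and>
     minimal_labels (word F) \<and> ascending_off S (word F) \<and> descending_on S (word F)"
proof -
  have "standard_filling ord (rib_rows S n) F \<longleftrightarrow> ascending_off S (word F) \<and> descending_on S (word F)"
    unfolding standard_filling_iff[OF S] ascending_off_def descending_on_def by auto
  moreover have "reading_word (rib_rows S n) F = map (word F) [0..<n]"
    unfolding reading_word_eq[OF S] by simp
  ultimately show ?thesis
    unfolding standard_nbc_fillings_def using nbc_plus_basis_iff[of "word F"] by auto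
qed

lemma minimal_labels_cong:
  assumes "\<And>p. p < n \<Longrightarrow> u p = w p" "minimal_labels w"
  shows "minimal_labels u"
proof -
  have "prefix_join u t = prefix_join w t" if "t \<le> n" for t
    using that assms(1) by (intro prefix_join_cong) auto
  then show ?thesis using assms unfolding minimal_labels_def by (simp add: Suc_leI less_imp_le)
qed

lemma ex_standard_nbc_filling:
  assumes "basis_word w" "minimal_labels w" "ascending_off S w" "descending_on S w"
  shows "\<exists>F \<in> standard_nbc_fillings S. flag S (word F) = flag S w"
proof -
  \<comment> \<open>Members of \<open>fillings\<close> are undefined off the ribbon, hence the
    \<open>restrict\<close>. The word of F agrees with w only at positions below n, which is all
    that the conditions on words inspect.\<close>
  define F where "F = restrict (w \<circ> inv (rib_cell S)) cells"
  have F: "word F p = w p" if "p < n" for p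
    using that inv_f_f[OF inj_rib_cell[OF S]] by (simp add: F_def rib_cells_eq[OF S])
  have J: "prefix_join (word F) t = prefix_join w t" if "t \<le> n" for t
    using that F by (intro prefix_join_cong) auto
  have "F \<in> fillings (rib_rows S n)"
    using assms(1) inv_f_f[OF inj_rib_cell[OF S]]
    by (auto simp: fillings_def F_def rib_cells_eq[OF S] basis_word_def)
  moreover have "basis_word (word F)" using assms(1) F J by (simp add: basis_word_def)
  moreover have "minimal_labels (word F)" using minimal_labels_cong[OF F assms(2)] .
  moreover have "ascending_off S (word F)" "descending_on S (word F)"
    using assms(3,4) F unfolding ascending_off_def descending_on_def by simp_all
  moreover have "flag S (word F) = flag S w" using flag_eq_iff[OF finite_S] J S by fastforce
  ultimately show ?thesis unfolding standard_nbc_fillings_iff[symmetric]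
    using standard_nbc_fillings_iff by blast
qed

lemma f_chain_eq: "f_chain S n F xs = (if xs = flag S (word F) then 1 else 0)"
proof -
  have "Sup (set (take s (reading_word (rib_rows S n) F))) = prefix_join (word F) s" if "s \<in> S" for s
    using that S prefix_join_set_take[of s "word F"] unfolding reading_word_eq[OF S]
    by (auto simp: comp_def)
  then show ?thesis unfolding f_chain_def flag_def using finite_S by (simp cong: map_cong)
qed

lemma f_chain_vF_eq:
  "f_chain_vF S n F xs =
     (\<Sum>\<sigma>\<in>col_group (rib_rows S n). of_int (sign \<sigma>) * (if xs = flag S (word (F \<circ> inv \<sigma>)) then 1 else 0))"
  by (simp add: f_chain_vF_def f_chain_eq)

text \<open>The join of all entries ignores their order; only intermediate joins move.\<close>

lemma basis_word_permuted:
  assumes F: "F \<in> standard_nbc_fillings S" and \<sigma>: "\<sigma> \<in> col_group (rib_rows S n)"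
  shows "basis_word (word (F \<circ> inv \<sigma>))"
proof -
  have "\<sigma> permutes cells" using \<sigma> by (simp add: col_group_def)
  then have "inv \<sigma> ` cells = cells" by (simp add: permutes_image permutes_inv)
  then have img: "inv \<sigma> ` rib_cell S ` {..<n} = rib_cell S ` {..<n}" by (simp add: rib_cells_eq[OF S])
  have w: "basis_word (word F)" using F standard_nbc_fillings_iff by blast
  have "prefix_join (word (F \<circ> inv \<sigma>)) n = prefix_join (word F) n"
    unfolding prefix_join_def using img by (metis image_comp)
  moreover have "is_atom (word (F \<circ> inv \<sigma>) p)" if "p < n" for p
  proof -
    have "inv \<sigma> (rib_cell S p) \<in> rib_cell S ` {..<n}" using img that by blast
    then show ?thesis using w by (auto simp: basis_word_def)
  qed
  ultimately show ?thesis using w by (simp add: basis_word_def)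
qed

lemma descending_on_column:
  assumes "descending_on S w" "q < n" "p < q" "snd (rib_cell S p) = snd (rib_cell S q)"
  shows "ord (w q) < ord (w p)"
proof -
  have "Suc r \<in> S" if "p \<le> r" "r < q" for r using same_col_in_ranks[OF S assms(4) that] .
  then have desc: "ord (w (Suc r)) < ord (w r)" if "p \<le> r" "r < q" for r
    using that assms(1,2) unfolding descending_on_def by auto
  have "ord (w r) < ord (w p)" if "Suc p \<le> r" "r \<le> q" for r
    using that
  proof (induction r rule: dec_induct)
    case base
    then show ?case using desc[of p] by simp
  next
    case (step r)
    then show ?case using desc[of r] by simp
  qed
  then show ?thesis using assms(3) by simp
qed

text \<open>A standard filling is decreasing along each column in reading order, hence its word is the
  largest one in its orbit.\<close>
lemma key_permuted_less:
  assumes F: "F \<in> standard_nbc_fillings S" and \<sigma>: "\<sigma> \<in> col_group (rib_rows S n)" "\<sigma> \<noteq> id"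
  shows "key (word (F \<circ> inv \<sigma>)) < key (word F)"
proof -
  define \<pi> where "\<pi> = inv \<sigma>"
  have perm: "\<sigma> permutes cells" using \<sigma> by (simp add: col_group_def)
  have \<pi>: "\<pi> permutes cells" unfolding \<pi>_def by (rule permutes_inv[OF perm])
  have "\<pi> \<noteq> id" using \<sigma>(2) perm by (metis \<pi>_def inv_id permutes_inv_inv)
  then obtain c where "\<pi> c \<noteq> c" by (metis eq_id_iff)
  then have "c \<in> cells" using \<pi> by (metis permutes_not_in)
  then have "\<exists>p. p < n \<and> \<pi> (rib_cell S p) \<noteq> rib_cell S p"
    using \<open>\<pi> c \<noteq> c\<close> by (auto simp: rib_cells_eq[OF S])
  then obtain p where p: "p < n" "\<pi> (rib_cell S p) \<noteq> rib_cell S p"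
    and first: "\<And>r. r < p \<Longrightarrow> \<pi> (rib_cell S r) = rib_cell S r"
    using exists_least_iff[of "\<lambda>p. p < n \<and> \<pi> (rib_cell S p) \<noteq> rib_cell S p"] by (metis less_trans)
  have pc: "rib_cell S p \<in> cells" using p(1) by (simp add: rib_cells_eq[OF S])
  then have "\<pi> (rib_cell S p) \<in> rib_cell S ` {..<n}"
    using col_group_inv(1)[OF \<sigma>(1), of "rib_cell S p"] by (simp add: \<pi>_def rib_cells_eq[OF S])
  then obtain q where q: "q < n" "\<pi> (rib_cell S p) = rib_cell S q" by blast
  have "p \<noteq> q" using p(2) q(2) by auto
  \<comment> \<open>Cells before position p are fixed by \<open>\<pi>\<close>, so injectivity leaves
    only a later cell of the same column, whose label is smaller.\<close>
  moreover have "\<not> q < p"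
  proof
    assume "q < p"
    then have "\<pi> (rib_cell S q) = \<pi> (rib_cell S p)" using first q(2) by simp
    then have "rib_cell S q = rib_cell S p" using permutes_inj[OF \<pi>] by (meson injD)
    then show False using \<open>q < p\<close> inj_rib_cell[OF S] by (auto dest: injD)
  qed
  moreover have "snd (rib_cell S p) = snd (rib_cell S q)"
    using col_group_inv(2)[OF \<sigma>(1) pc] q(2) by (simp add: \<pi>_def)
  ultimately have "ord (word F q) < ord (word F p)"
    using descending_on_column[of "word F" q p] F q(1) standard_nbc_fillings_iff by simp
  then show ?thesis
    unfolding key_less_iff \<pi>_def[symmetric] using p(1) q(2) first by (intro exI[of _ p]) auto
qed

lemma id_col_group: "id \<in> col_group (rib_rows S n)"
  by (simp add: col_group_def permutes_id)

lemma key_le_of_flag: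
  assumes "F \<in> standard_nbc_fillings S" "basis_word u" "flag S u = flag S (word F)"
  shows "key (word F) \<le> key u"
  using assms S flag_eq_iff[OF finite_S] unfolding standard_nbc_fillings_iff
  by (intro key_le_of_ascending) auto

text \<open>A second column permutation with the same flag would produce a word of that flag below
  its first word.\<close>

lemma f_chain_vF_diagonal:
  assumes F: "F \<in> standard_nbc_fillings S"
  shows "f_chain_vF S n F (flag S (word F)) = 1"
proof -
  have ne: "flag S (word F) \<noteq> flag S (word (F \<circ> inv \<sigma>))"
    if "\<sigma> \<in> col_group (rib_rows S n)" "\<sigma> \<noteq> id" for \<sigma>
    using key_le_of_flag[OF F basis_word_permuted[OF F that(1)]] key_permuted_less[OF F that] by auto
  have "f_chain_vF S n F (flag S (word F)) = (\<Sum>\<sigma>\<in>col_group (rib_rows S n). if \<sigma> = id then 1 else 0)"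
    unfolding f_chain_vF_eq using ne by (intro sum.cong) (auto simp: sign_id)
  then show ?thesis using finite_col_group[OF finite_cells] id_col_group by simp
qed

text \<open>The word of G is first for its flag, hence at most the permuted word of F, hence at most
  the word of F. In the case of equal keys the words agree, and being undefined off the ribbon the
  fillings agree as well.\<close>

lemma f_chain_vF_triangular:
  assumes F: "F \<in> standard_nbc_fillings S" and G: "G \<in> standard_nbc_fillings S"
    and nz: "f_chain_vF S n F (flag S (word G)) \<noteq> 0"
  shows "F = G \<or> key (word G) < key (word F)"
proof -
  obtain \<sigma> where \<sigma>: "\<sigma> \<in> col_group (rib_rows S n)" "flag S (word G) = flag S (word (F \<circ> inv \<sigma>))"
  proof (rule ccontr)
    assume "\<not> thesis"
    then have "f_chain_vF S n F (flag S (word G)) = 0"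
      unfolding f_chain_vF_eq using that by (intro sum.neutral) auto
    then show False using nz by simp
  qed
  have le: "key (word G) \<le> key (word (F \<circ> inv \<sigma>))"
    using key_le_of_flag[OF G basis_word_permuted[OF F \<sigma>(1)]] \<sigma>(2) by simp
  show ?thesis
  proof (cases "\<sigma> = id")
    case False
    then show ?thesis using le key_permuted_less[OF F \<sigma>(1)] by (auto intro: le_less_trans)
  next
    case True
    then have le: "key (word G) \<le> key (word F)" using le by simp
    have "F = G" if eq: "key (word G) = key (word F)"
    proof -
      have "word F p = word G p" if "p < n" for p
        using key_eq[OF _ _ eq that] F G standard_nbc_fillings_iff by simp
      then have "F c = G c" if "c \<in> cells" for c using that by (auto simp: rib_cells_eq[OF S])
      moreover have "F \<in> extensional cells" "G \<in> extensional cells"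
        using F G standard_nbc_fillings_iff by (auto simp: fillings_def PiE_def)
      ultimately show "F = G" by (metis extensionalityI)
    qed
    then show ?thesis using le by auto
  qed
qed

text \<open>Swapping the two boxes of a column at a rank s in S changes the sign of a column permutation,
  but only affects the element of rank s in the associated flag.\<close>
lemma f_chain_vF_cycle:
  assumes F: "F \<in> standard_nbc_fillings S"
  shows "f_chain_vF S n F \<in> cycles (rank_selected S) (card S)"
proof -
  let ?C = "col_group (rib_rows S n)"
  let ?O = "osimplices (rank_selected S :: 'a set) (card S)"
  let ?L = "\<lambda>\<sigma>. flag S (word (F \<circ> inv \<sigma>))"
  have L: "?L \<sigma> \<in> ?O" if "\<sigma> \<in> ?C" for \<sigma>
    using flag_osimplices[OF basis_word_permuted[OF F that] S] .
  have finC: "finite ?C" using finite_col_group[OF finite_cells] .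
  have zero: "(\<Sum>\<sigma>\<in>?C. if del_nth i (?L \<sigma>) = \<tau> then of_int (sign \<sigma>) else 0) = (0::complex)"
    if i: "i < card S" for i \<tau>
  proof -
    have "sorted_list_of_set S ! i \<in> S"
      using i finite_S nth_mem[of i "sorted_list_of_set S"] by simp
    then obtain p where p: "sorted_list_of_set S ! i = Suc p" "Suc p \<in> S" "Suc p < n"
      using S by (cases "sorted_list_of_set S ! i") auto
    \<comment> \<open>As \<open>Suc p\<close> is in S, these two cells lie one above the other, so
      \<open>t\<close> belongs to the column group.\<close>
    define t where "t = transpose (rib_cell S p) (rib_cell S (Suc p))"
    have inC: "rib_cell S p \<in> cells" "rib_cell S (Suc p) \<in> cells"
      using p(3) by (auto simp: rib_cells_eq[OF S])
    have t: "t permutes cells" unfolding t_def using inC by (rule permutes_swap_id)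
    have col: "snd (t c) = snd c" for c
      using rib_cell_Suc[OF S, of p] p(2) by (auto simp: t_def transpose_def)
    have tt: "t \<circ> t = id" by (simp add: t_def fun_eq_iff)
    have ne: "rib_cell S p \<noteq> rib_cell S (Suc p)" using inj_rib_cell[OF S] by (auto dest: injD)
    have closed: "t \<circ> \<sigma> \<in> ?C" if "\<sigma> \<in> ?C" for \<sigma>
      using that t col by (auto simp: col_group_def intro: permutes_compose)
    have bij: "bij_betw (\<lambda>\<sigma>. t \<circ> \<sigma>) ?C ?C"
      by (rule bij_betwI[where g = "\<lambda>\<sigma>. t \<circ> \<sigma>"]) (auto simp: closed tt simp flip: comp_assoc)
    have sgn: "sign (t \<circ> \<sigma>) = - sign \<sigma>" if "\<sigma> \<in> ?C" for \<sigma>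
    proof -
      have "permutation t" "permutation \<sigma>"
        using t that finite_cells by (auto simp: col_group_def permutation_permutes)
      then show ?thesis using ne by (simp add: sign_compose t_def sign_swap_id)
    qed
    \<comment> \<open>Composition on the left puts \<open>t\<close> innermost in the inverse, where
      it acts on positions: the word changes by exchanging the letters at \<open>p\<close> and
      \<open>Suc p\<close>, which affects only the vertex of rank \<open>Suc p\<close>.\<close>
    have flag: "del_nth i (?L (t \<circ> \<sigma>)) = del_nth i (?L \<sigma>)" if "\<sigma> \<in> ?C" for \<sigma>
    proof -
      have "\<sigma> permutes cells" using that by (simp add: col_group_def)
      then have "inv (t \<circ> \<sigma>) = inv \<sigma> \<circ> t"
        using t tt by (metis inv_unique_comp o_inv_distrib permutes_bij)
      moreover have "t (rib_cell S q) = rib_cell S (transpose p (Suc p) q)" for q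
        using inj_rib_cell[OF S] by (auto simp: t_def transpose_def dest: injD)
      ultimately have "word (F \<circ> inv (t \<circ> \<sigma>)) = word (F \<circ> inv \<sigma>) \<circ> transpose p (Suc p)"
        by (intro ext) simp
      then have "\<forall>s\<in>S - {Suc p}. prefix_join (word (F \<circ> inv (t \<circ> \<sigma>))) s = prefix_join (word (F \<circ> inv \<sigma>)) s"
        using prefix_join_transpose by (metis Diff_iff insertI1)
      then show ?thesis
        using del_nth_flag[OF finite_S i] p(1) flag_eq_iff[of "S - {Suc p}"] finite_S by simp
    qed
    let ?T = "\<Sum>\<sigma>\<in>?C. if del_nth i (?L \<sigma>) = \<tau> then of_int (sign \<sigma>) else (0::complex)"
    have "?T = (\<Sum>\<sigma>\<in>?C. if del_nth i (?L (t \<circ> \<sigma>)) = \<tau> then of_int (sign (t \<circ> \<sigma>)) else 0)"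
      using sum.reindex_bij_betw[OF bij, symmetric] by blast
    also have "\<dots> = (\<Sum>\<sigma>\<in>?C. - (if del_nth i (?L \<sigma>) = \<tau> then of_int (sign \<sigma>) else 0))"
      by (intro sum.cong refl) (simp add: flag sgn)
    also have "\<dots> = - ?T" by (simp only: sum_negf)
    finally show ?thesis by simp
  qed
  have "obound (rank_selected S) (card S) (f_chain_vF S n F) \<tau> = 0" for \<tau>
  proof -
    \<comment> \<open>Each \<open>\<sigma>\<close> contributes to the single simplex
      \<open>?L \<sigma>\<close>, so the sum over simplices collapses to one signed sum over the
      column group for each deleted index.\<close>
    have "obound (rank_selected S) (card S) (f_chain_vF S n F) \<tau> =
       (\<Sum>i<card S. \<Sum>xs\<in>?O. \<Sum>\<sigma>\<in>?C. if xs = ?L \<sigma> then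
          (-1) ^ i * (if del_nth i (?L \<sigma>) = \<tau> then of_int (sign \<sigma>) else 0) else 0)"
      unfolding obound_def f_chain_vF_eq
      by (subst sum.swap) (auto simp: sum_distrib_left intro!: sum.cong sum.neutral)
    also have "\<dots> = (\<Sum>i<card S. \<Sum>\<sigma>\<in>?C. \<Sum>xs\<in>?O. if xs = ?L \<sigma> then
          (-1) ^ i * (if del_nth i (?L \<sigma>) = \<tau> then of_int (sign \<sigma>) else 0) else 0)"
      by (intro sum.cong refl sum.swap)
    also have "\<dots> = (\<Sum>i<card S. \<Sum>\<sigma>\<in>?C. (-1) ^ i * (if del_nth i (?L \<sigma>) = \<tau> then of_int (sign \<sigma>) else 0))"
      using L by (intro sum.cong refl) (simp add: finite_osimplices)
    also have "\<dots> = (\<Sum>i<card S. (-1) ^ i * (\<Sum>\<sigma>\<in>?C. if del_nth i (?L \<sigma>) = \<tau> then of_int (sign \<sigma>) else 0))"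
      by (simp only: sum_distrib_left)
    also have "\<dots> = 0"
      by (rule sum.neutral) (simp add: zero)
    finally show ?thesis .
  qed
  moreover have "f_chain_vF S n F xs = 0" if "xs \<notin> ?O" for xs
    unfolding f_chain_vF_eq using L that by (intro sum.neutral) auto
  ultimately show ?thesis by (simp add: cycles_def ochains_def)
qed

text \<open>The triangular system matches a cycle z with a combination on the flags of standard
  fillings; the difference is a cycle vanishing there, hence 0. Evaluation on the same flags gives
  uniqueness.\<close>

lemma homology_basis_standard_nbc_fillings:
  "homology_basis (rank_selected S :: 'a set) (card S) (standard_nbc_fillings S) (f_chain_vF S n)"
proof -
  let ?I = "standard_nbc_fillings S"
  let ?v = "f_chain_vF S n"
  let ?M = "\<lambda>F G. ?v F (flag S (word G))"
  have fin: "finite ?I"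
  proof (rule finite_subset)
    show "?I \<subseteq> fillings (rib_rows S n)" by (auto simp: standard_nbc_fillings_def)
    show "finite (fillings (rib_rows S n) :: (nat \<times> nat \<Rightarrow> 'a) set)"
      unfolding fillings_def by (intro finite_PiE finite_cells) simp
  qed
  have diag: "?M F F = 1" if "F \<in> ?I" for F using f_chain_vF_diagonal that .
  have tri: "F = G \<or> key (word G) < key (word F)" if "F \<in> ?I" "G \<in> ?I" "?M F G \<noteq> 0" for F G
    using f_chain_vF_triangular that .
  have sol_ex: "\<exists>a. \<forall>G\<in>?I. (\<Sum>F\<in>?I. a F * ?M F G) = b G" for b
    by (rule triangular_solution[of ?I ?M "\<lambda>F. key (word F)" b]; (fact fin | fact diag | fact tri))
  have ker: "\<forall>F\<in>?I. a F = 0" if "\<forall>G\<in>?I. (\<Sum>F\<in>?I. a F * ?M F G) = 0" for a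
    by (rule triangular_kernel[of ?I ?M "\<lambda>F. key (word F)" a]; (fact fin | fact diag | fact tri | fact that))
  have ex1: "\<exists>!a. a \<in> extensional ?I \<and> (\<lambda>xs. z xs - (\<Sum>F\<in>?I. a F * ?v F xs)) \<in> boundaries (rank_selected S) (card S)"
    if z: "z \<in> cycles (rank_selected S) (card S)" for z
  proof -
    have bnd: "(\<lambda>xs. z xs - (\<Sum>F\<in>?I. a F * ?v F xs)) \<in> boundaries (rank_selected S) (card S) \<longleftrightarrow>
      (\<forall>xs. (\<Sum>F\<in>?I. a F * ?v F xs) = z xs)" for a
      by (auto simp: boundaries_rank_selected[OF finite_S] fun_eq_iff)
    obtain a where a: "\<forall>G\<in>?I. (\<Sum>F\<in>?I. a F * ?M F G) = z (flag S (word G))"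
      using sol_ex[of "\<lambda>G. z (flag S (word G))"] by blast
    \<comment> \<open>Coefficients are unique only once their values outside the index set are
      fixed, hence the \<open>restrict\<close>.\<close>
    define a' where "a' = restrict a ?I"
    have a': "(\<Sum>F\<in>?I. a' F * ?v F xs) = (\<Sum>F\<in>?I. a F * ?v F xs)" for xs
      by (simp add: a'_def cong: sum.cong)
    let ?y = "\<lambda>xs. z xs - (\<Sum>F\<in>?I. a' F * ?v F xs)"
    have cyc: "?y \<in> cycles (rank_selected S) (card S)"
      by (intro cycles_combination fin z f_chain_vF_cycle)
    have "?y (flag S w) = 0"
      if "basis_word w" "minimal_labels w" "ascending_off S w" "descending_on S w" for w
      using ex_standard_nbc_filling[OF that] a a' by force
    then have "?y xs = 0" for xs using cycle_vanishes[OF S cyc] by blast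
    then have sol: "\<forall>xs. (\<Sum>F\<in>?I. a' F * ?v F xs) = z xs" by simp
    show ?thesis
    proof (intro ex1I[of _ a'] conjI)
      show "a' \<in> extensional ?I" by (simp add: a'_def)
      show "?y \<in> boundaries (rank_selected S) (card S)" using sol bnd by blast
    next
      fix b assume b: "b \<in> extensional ?I \<and>
        (\<lambda>xs. z xs - (\<Sum>F\<in>?I. b F * ?v F xs)) \<in> boundaries (rank_selected S) (card S)"
      then have "\<forall>G\<in>?I. (\<Sum>F\<in>?I. (b F - a' F) * ?M F G) = 0"
        using sol bnd by (simp add: left_diff_distrib sum_subtractf)
      then have "\<forall>F\<in>?I. b F - a' F = 0" by (rule ker)
      then show "b = a'" using b by (intro extensionalityI[of b ?I]) (auto simp: a'_def)
    qed
  qed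
  show ?thesis
    unfolding homology_basis_def using fin f_chain_vF_cycle ex1 by blast
qed

end

end

theorem theorem5p29:
  fixes ord :: "'a::finite_lattice_complete \<Rightarrow> nat"
    and S :: "nat set" and n :: nat
  assumes "geometric_lattice TYPE('a)"
    and "rk (top::'a) = n"
    and "inj_on ord {a::'a. is_atom a}"
    and "S \<subseteq> {1..<n}"
  shows "homology_basis (rank_selected S :: 'a set) (card S)
           {F \<in> fillings (rib_rows S n). standard_filling ord (rib_rows S n) F \<and>
                 nbc_plus_basis ord (reading_word (rib_rows S n) F)}
           (f_chain_vF S n)"
proof -
  interpret ordered_geometric_lattice ord n
    using assms(1-3) by unfold_locales
  show ?thesis
    using homology_basis_standard_nbc_fillings[OF assms(4)] unfolding standard_nbc_fillings_def .
qed

end
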